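(* Let $V=V_n$ be a normalized variance profile satisfying (A1) and (A6) of the context, and let $\mu_n$ be the associated probability measure on $\mathbb{C}$, with density $f_n$ and $f_n(0)=\lim_{z\to0}f_n(z)$ (which exists). Then the density of $\mu_n$ at zero satisfies $$f_n(0)\ \ge\ \frac{1}{\pi\rho(V)},$$ with equality if and only if $V=D^{-1}SD$ for some diagonal matrix $D$ with positive diagonal entries and some doubly stochastic matrix $S$ (in the sense of the context). In the latter case, $\mu_n$ is the circular law, i.e. the uniform probability measure on the disc $\{z\in\mathbb{C}:|z|\le\sqrt{\rho(V)}\}$.
   Context: Write $[n]=\{1,\dots,n\}$, and $\rho(\cdot)$ for the spectral radius. $A_n=(\sigma_{ij})$ is a deterministic $n\times n$ matrix with nonnegative entries (standard deviation profile) and $V=V_n=\big(\tfrac1n\sigma_{ij}^2\big)_{i,j\in[n]}$ is the normalized variance profile. Doubly stochastic: here, an $n\times n$ nonnegative matrix $S$ is called doubly stochastic if all its row sums and all its column sums are equal to one common constant $\mathcal V>0$. (A1) $\max_{i,j}\sigma_{ij}\le\sigma_{\max}$ for some $\sigma_{\max}\in(0,\infty)$ (uniformly in $n$ when a sequence is considered). Fully indecomposable: a $K\times K$ matrix $T=(t_{ij})$ with nonnegative entries is fully indecomposable if for any two nonempty subsets $I,J\subset[K]$ with $|I|+|J|\ge K$ the submatrix $(t_{ij})_{i\in I,j\in J}$ contains a nonzero entry. (A6) There are $\phi>0$, $K\in\mathbb{N}$ dividing $n$ (not depending on $n$ when a sequence is considered), a fully indecomposable matrix $Z=(z_{ij})_{i,j\in[K]}$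 with $z_{ij}\in\{0,1\}$ and a partition $(I_j)_{j\in[K]}$ of $[n]$ such that $|I_i|=n/K$ and $V_{xy}\ge\frac{\phi}{n}z_{ij}$ for all $x\in I_i$, $y\in I_j$, $i,j\in[K]$. (This implies that $V$ is irreducible.) Master Equations: for $s>0$, consider $$q_i=\frac{(V^{\mathsf T}q)_i}{s^2+(V\widetilde q)_i(V^{\mathsf T}q)_i},\quad \widetilde q_i=\frac{(V\widetilde q)_i}{s^2+(V\widetilde q)_i(V^{\mathsf T}q)_i},\quad \sum_{i}q_i=\sum_i\widetilde q_i,\quad q_i,\widetilde q_i\ge0 .$$ It is known that, for irreducible $V$, this system has only the zero solution when $s\ge\sqrt{\rho(V)}$ and has a unique nonzero solution (entrywise positive) when $s\in(0,\sqrt{\rho(V)})$. $(q(s),\widetilde q(s))$ denotes this nonzero solution when $s<\sqrt{\rho(V)}$ and $0$ when $s\ge\sqrt{\rho(V)}$; it is continuous on $(0,\infty)$ and continuously differentiable on $(0,\sqrt{\rho(V)})$. The measure $\mu_n$: the function $F_n(s)=1-\frac1n\langle q(s),V\widetilde q(s)\rangle$, $s>0$, extends to an absolutely continuous function on $[0,\infty)$ which is a CDF, and $\mu_n$ is the unique radially symmetric probability measure on $\mathbb{C}$ with $\mu_n(\{|z|\le s\})=F_n(s)$ for $s>0$. Its density on $\mathbb{C}\setminus\{0\}$ is $f_n(z)=\frac{1}{2\pi|z|}F_n'(|z|)$ for $|z|\notin\{0,\sqrt{\rho(V)}\}$ (and $f_n(z)=0$ for $|z|=\sqrt{\rho(V)}$).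 *)

theory Defs
  imports "HOL-Analysis.Analysis" "HOL-Probability.Probability"
begin

text \<open>
  The index set $[n]$ is the finite type \<open>'n\<close>, so that $n$ is \<open>CARD('n)\<close>; the block
  indices $[K]$ are the natural numbers \<open>{1..K}\<close>, because $K$ is existentially quantified.
\<close>

definition normalized_variance_profile :: "real^'n^'n \<Rightarrow> real^'n^'n" where
  "normalized_variance_profile \<sigma> = (\<chi> i j. (\<sigma> $ i $ j)\<^sup>2 / real CARD('n))"

definition complex_eigenvalues :: "real^'n^'n \<Rightarrow> complex set" where
  "complex_eigenvalues A =
     {k. \<exists>v :: complex^'n. v \<noteq> 0 \<and> (\<chi> i j. complex_of_real (A $ i $ j)) *v v = k *s v}"

definition spec_radius :: "real^'n^'n \<Rightarrow> real" where
  "spec_radius A = Max (cmod ` complex_eigenvalues A)"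

text \<open>The common row and column sum is an arbitrary positive constant, not necessarily \<open>1\<close>.\<close>

definition doubly_stochastic :: "real^'n^'n \<Rightarrow> bool" where
  "doubly_stochastic S \<longleftrightarrow>
     (\<forall>i j. 0 \<le> S $ i $ j) \<and>
     (\<exists>c>0. (\<forall>i. (\<Sum>j\<in>UNIV. S $ i $ j) = c) \<and> (\<forall>j. (\<Sum>i\<in>UNIV. S $ i $ j) = c))"

definition fully_indecomposable :: "nat \<Rightarrow> (nat \<Rightarrow> nat \<Rightarrow> real) \<Rightarrow> bool" where
  "fully_indecomposable K T \<longleftrightarrow>
     (\<forall>i\<in>{1..K}. \<forall>j\<in>{1..K}. 0 \<le> T i j) \<and>
     (\<forall>I J. I \<subseteq> {1..K} \<and> J \<subseteq> {1..K} \<and> I \<noteq> {} \<and> J \<noteq> {} \<and> K \<le> card I + card J \<longrightarrow>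
        (\<exists>i\<in>I. \<exists>j\<in>J. T i j \<noteq> 0))"

definition bounded_profile :: "real^'n^'n \<Rightarrow> bool" where
  "bounded_profile \<sigma> \<longleftrightarrow> (\<exists>\<sigma>max>0. \<forall>i j. \<sigma> $ i $ j \<le> \<sigma>max)"

definition block_fully_indecomposable :: "real^'n^'n \<Rightarrow> bool" where
  "block_fully_indecomposable V \<longleftrightarrow>
     (\<exists>(\<phi>::real) (K::nat) (Z::nat \<Rightarrow> nat \<Rightarrow> real) (I::nat \<Rightarrow> 'n set).
        \<phi> > 0 \<and> K dvd CARD('n) \<and>
        (\<forall>i\<in>{1..K}. \<forall>j\<in>{1..K}. Z i j \<in> {0, 1}) \<and> fully_indecomposable K Z \<and>
        disjoint_family_on I {1..K} \<and> (\<Union>i\<in>{1..K}. I i) = UNIV \<and>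
        (\<forall>i\<in>{1..K}. card (I i) = CARD('n) div K) \<and>
        (\<forall>i\<in>{1..K}. \<forall>j\<in>{1..K}. \<forall>x\<in>I i. \<forall>y\<in>I j.
           V $ x $ y \<ge> \<phi> / real CARD('n) * Z i j))"

definition master_equations :: "real^'n^'n \<Rightarrow> real \<Rightarrow> real^'n \<Rightarrow> real^'n \<Rightarrow> bool" where
  "master_equations V s q q' \<longleftrightarrow>
     (\<forall>i. q $ i = (transpose V *v q) $ i /
              (s\<^sup>2 + (V *v q') $ i * (transpose V *v q) $ i)) \<and>
     (\<forall>i. q' $ i = (V *v q') $ i /
              (s\<^sup>2 + (V *v q') $ i * (transpose V *v q) $ i)) \<and>
     (\<Sum>i\<in>UNIV. q $ i) = (\<Sum>i\<in>UNIV. q' $ i) \<and>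
     (\<forall>i. 0 \<le> q $ i) \<and> (\<forall>i. 0 \<le> q' $ i)"

text \<open>The pair $(q(s), \widetilde q(s))$; only its values at $s > 0$ are meaningful.\<close>

definition master_solution :: "real^'n^'n \<Rightarrow> real \<Rightarrow> (real^'n) \<times> (real^'n)" where
  "master_solution V s =
     (if s < sqrt (spec_radius V)
      then (THE p. master_equations V s (fst p) (snd p) \<and> p \<noteq> (0, 0))
      else (0, 0))"

definition master_cdf :: "real^'n^'n \<Rightarrow> real \<Rightarrow> real" where
  "master_cdf V s =
     1 - (fst (master_solution V s) \<bullet> (V *v snd (master_solution V s))) / real CARD('n)"

definition radially_symmetric :: "complex measure \<Rightarrow> bool" where
  "radially_symmetric M \<longleftrightarrow> (\<forall>\<theta>::real. distr M borel (\<lambda>z. cis \<theta> * z) = M)"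

definition master_measure :: "real^'n^'n \<Rightarrow> complex measure" where
  "master_measure V =
     (THE M. prob_space M \<and> sets M = sets borel \<and> radially_symmetric M \<and>
             (\<forall>s>0. measure M {z. cmod z \<le> s} = master_cdf V s))"

text \<open>
  Density of \<open>master_measure V\<close> away from the origin: radial symmetry gives
  $F'(s) = 2 \pi s f(s)$ for the density $f$, written as a function of the radius. On the circle of radius $\sqrt{\rho(V)}$, where $F$ need not be
  differentiable, the value $0$ is a convention. At the origin the density is defined by its limit.
\<close>

definition punctured_density :: "real^'n^'n \<Rightarrow> complex \<Rightarrow> real" where
  "punctured_density V z =
     (if cmod z = sqrt (spec_radius V) then 0
      else deriv (master_cdf V) (cmod z) / (2 * pi * cmod z))"

definition master_density :: "real^'n^'n \<Rightarrow> complex \<Rightarrow> real" where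
  "master_density V z =
     (if z = 0 then Lim (at 0) (punctured_density V) else punctured_density V z)"

end

theory Submission
  imports Defs
begin

text \<open>
  Put \<open>a = V q'\<close> and \<open>b = V\<^sup>T q\<close>. For a solution of the master equations at \<open>s > 0\<close> one has
  \<open>1 - q\<^sub>i a\<^sub>i = s\<^sup>2 / (s\<^sup>2 + a\<^sub>i b\<^sub>i)\<close>, so the radial distribution function is the average over \<open>i\<close>
  of \<open>s\<^sup>2 / (s\<^sup>2 + a\<^sub>i b\<^sub>i)\<close>. At \<open>s = 0\<close> the equations become \<open>q\<^sub>i a\<^sub>i = q'\<^sub>i b\<^sub>i = 1\<close>: the matrix
  \<open>diag(q) V diag(q')\<close> has unit row and column sums, that is, the solution \<open>(p, p')\<close> at \<open>s = 0\<close> is the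
  Sinkhorn scaling of \<open>V\<close>. It exists because \<open>V\<close> is fully indecomposable
  (\<open>sinkhorn_scaling\<close>), the linearised equations are nondegenerate there, and so it extends to a
  differentiable curve of solutions in the parameter \<open>t = s\<^sup>2\<close> (\<open>perturbed_master_solutions\<close>). By
  uniqueness (\<open>master_solution_unique\<close>) this curve is the master solution for small \<open>s\<close>, and the
  density at the origin is \<open>(1 / \<pi> n) \<Sum>\<^sub>i p\<^sub>i p'\<^sub>i\<close> (\<open>punctured_density_tendsto\<close>).

  The claimed bound is thus \<open>\<rho> \<Sum>\<^sub>i p\<^sub>i p'\<^sub>i \<ge> n\<close> (\<open>scaled_sum_ge\<close>). Let \<open>x\<close> be the Perron vector of \<open>V\<close>,
  \<open>S = diag(p) V diag(p')\<close> and \<open>y = x / p'\<close>. Then \<open>\<rho> p\<^sub>i p'\<^sub>i = \<Sum>\<^sub>j S\<^sub>i\<^sub>j y\<^sub>j / y\<^sub>i\<close>. Summing over \<open>i\<close> and using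
  \<open>u \<ge> 1 + ln u\<close> gives at least \<open>n\<close>, since the logarithms cancel when all row and column sums
  of \<open>S\<close> are one. Equality forces \<open>y\<^sub>i = y\<^sub>j\<close> along the edges of \<open>V\<close>, so \<open>y\<close> is constant
  and \<open>\<rho> p\<^sub>i p'\<^sub>i = 1\<close>; then \<open>p\<close> and its entrywise reciprocal are a left and a right Perron vector,
  which says exactly that \<open>diag(p)\<close> conjugates \<open>V\<close> to a doubly stochastic matrix
  (\<open>diagonally_doubly_stochastic_iff\<close>).

  Conversely, if \<open>d\<close> and \<open>1 / d\<close> are left and right Perron vectors, suitable multiples of them solve
  the master equations for every \<open>s < \<surd>\<rho>\<close> and the distribution function is \<open>s\<^sup>2 / \<rho>\<close>
  (\<open>reciprocal_eigenvectors_cdf\<close>). This is the one of the uniform measure on the disc of radius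
  \<open>\<surd>\<rho>\<close>, and a radially symmetric probability measure is determined by its radial distribution
  function (\<open>radially_symmetric_eqI\<close>).
\<close>

section \<open>Fully indecomposable variance profiles and their Perron root\<close>

text \<open>
  The block hypothesis enters only through this entrywise form: full indecomposability of the
  whole \<open>n \<times> n\<close> matrix.
\<close>

locale fully_indecomposable_profile =
  fixes V :: "real^'n^'n"
  assumes nonneg: "0 \<le> V $ i $ j"
    and positive_entry: "I \<noteq> {} \<Longrightarrow> J \<noteq> {} \<Longrightarrow> CARD('n) \<le> card I + card J \<Longrightarrow>
      \<exists>i\<in>I. \<exists>j\<in>J. 0 < V $ i $ j"

text \<open>
  If \<open>I\<close> and \<open>J\<close> carry a total of \<open>n\<close> indices, then the blocks they meet number at least \<open>K\<close> in total,
  because each block has \<open>n / K\<close> elements. Hence \<open>Z\<close> has a nonzero entry between a block met by \<open>I\<close> and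
  one met by \<open>J\<close>, and \<open>V\<close> is positive on all of the corresponding block rectangle.
\<close>

lemma block_fully_indecomposable_imp_profile:
  fixes V :: "real^'n^'n"
  assumes nn: "\<And>i j. 0 \<le> V $ i $ j" and "block_fully_indecomposable V"
  shows "fully_indecomposable_profile V"
proof -
  from assms obtain \<phi> :: real and K :: nat and Z :: "nat \<Rightarrow> nat \<Rightarrow> real" and P :: "nat \<Rightarrow> 'n set"
    where phi: "\<phi> > 0" and dvd: "K dvd CARD('n)"
      and Z01: "\<And>i j. i \<in> {1..K} \<Longrightarrow> j \<in> {1..K} \<Longrightarrow> Z i j \<in> {0, 1}"
      and Z: "fully_indecomposable K Z"
      and cov: "(\<Union>i\<in>{1..K}. P i) = UNIV"
      and crd: "\<And>i. i \<in> {1..K} \<Longrightarrow> card (P i) = CARD('n) div K"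
      and lb: "\<And>i j x y. i \<in> {1..K} \<Longrightarrow> j \<in> {1..K} \<Longrightarrow> x \<in> P i \<Longrightarrow> y \<in> P j \<Longrightarrow>
           V $ x $ y \<ge> \<phi> / real CARD('n) * Z i j"
    unfolding block_fully_indecomposable_def by metis
  define m where "m = CARD('n) div K"
  have n: "CARD('n) = K * m" using dvd by (simp add: m_def)
  have m: "0 < m" using n by (metis mult_0_right neq0_conv zero_less_card_finite)
  define blocks where "blocks = (\<lambda>A. {k \<in> {1..K}. P k \<inter> A \<noteq> {}})"
  have sub: "blocks A \<subseteq> {1..K}" for A by (auto simp: blocks_def)
  have ne: "blocks A \<noteq> {}" if "A \<noteq> {}" for A
  proof -
    obtain x where "x \<in> A" using \<open>A \<noteq> {}\<close> by blast
    moreover obtain k where "k \<in> {1..K}" "x \<in> P k" using cov by blast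
    ultimately show ?thesis by (auto simp: blocks_def)
  qed
  have size: "card A \<le> card (blocks A) * m" for A
  proof -
    have "A \<subseteq> (\<Union>k\<in>blocks A. P k)"
    proof
      fix x assume "x \<in> A"
      moreover obtain k where "k \<in> {1..K}" "x \<in> P k" using cov by blast
      ultimately show "x \<in> (\<Union>k\<in>blocks A. P k)" by (auto simp: blocks_def)
    qed
    then have "card A \<le> card (\<Union>k\<in>blocks A. P k)" by (intro card_mono) auto
    also have "\<dots> \<le> (\<Sum>k\<in>blocks A. card (P k))"
      by (intro card_UN_le) (auto simp: blocks_def)
    also have "\<dots> = (\<Sum>k\<in>blocks A. m)"
      by (intro sum.cong) (auto simp: blocks_def crd m_def)
    finally show ?thesis by simp
  qed
  show ?thesis
  proof
    fix I J :: "'n set"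
    assume I: "I \<noteq> {}" and J: "J \<noteq> {}" and c: "CARD('n) \<le> card I + card J"
    have "K * m \<le> (card (blocks I) + card (blocks J)) * m"
      using c size[of I] size[of J] n by (simp add: algebra_simps)
    then have "K \<le> card (blocks I) + card (blocks J)" using m by simp
    then have "\<exists>i\<in>blocks I. \<exists>j\<in>blocks J. Z i j \<noteq> 0"
      using Z sub[of I] sub[of J] ne[OF I] ne[OF J] unfolding fully_indecomposable_def by blast
    then obtain i j where ij: "i \<in> blocks I" "j \<in> blocks J" "Z i j \<noteq> 0" by blast
    then have "i \<in> {1..K}" "j \<in> {1..K}" using sub by blast+
    then have Z1: "Z i j = 1" using Z01 ij by blast
    obtain x y where xy: "x \<in> P i" "x \<in> I" "y \<in> P j" "y \<in> J" using ij by (auto simp: blocks_def)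
    have "0 < \<phi> / real CARD('n) * Z i j" using phi Z1 by simp
    also have "\<dots> \<le> V $ x $ y" using lb \<open>i \<in> {1..K}\<close> \<open>j \<in> {1..K}\<close> xy by blast
    finally show "\<exists>i\<in>I. \<exists>j\<in>J. 0 < V $ i $ j" using xy by blast
  qed (rule nn)
qed

lemma matrix_vector_nth: "(A *v x) $ i = (\<Sum>j\<in>UNIV. A $ i $ j * x $ j)"
  by (simp add: matrix_vector_mult_def)

lemma transpose_vector_nth: "(transpose A *v x) $ j = (\<Sum>i\<in>UNIV. A $ i $ j * x $ i)"
  by (simp add: matrix_vector_mult_def transpose_def)

context fully_indecomposable_profile
begin

lemma transpose_profile: "fully_indecomposable_profile (transpose V)"
proof
  fix I J :: "'n set"
  assume "I \<noteq> {}" "J \<noteq> {}" "CARD('n) \<le> card I + card J"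
  then show "\<exists>i\<in>I. \<exists>j\<in>J. 0 < transpose V $ i $ j"
    using positive_entry[of J I] by (auto simp: transpose_def add.commute)
qed (simp add: transpose_def nonneg)

text \<open>
  Applied to \<open>- E\<close> and \<open>E\<close>, whose sizes add up to exactly \<open>n\<close>. A set of
  extremal indices that spreads along the edges of \<open>V\<close> is therefore everything.
\<close>

lemma irreducible:
  assumes "E \<noteq> {}" and closed: "\<And>i j. 0 < V $ i $ j \<Longrightarrow> j \<in> E \<Longrightarrow> i \<in> E"
  shows "E = UNIV"
proof (rule ccontr)
  assume "E \<noteq> UNIV"
  then have "- E \<noteq> {}" by blast
  moreover have "card (- E) + card E = CARD('n)"
    by (metis Compl_partition2 Compl_disjoint2 card_Un_disjoint finite)
  ultimately show False using positive_entry[of "- E" E] assms by fastforce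
qed

text \<open>
  Connectedness of the bipartite graph of rows and columns, which is stronger than irreducibility:
  a nontrivial pair \<open>E, F\<close> would give the two vanishing rectangles \<open>E \<times> - F\<close> and \<open>- E \<times> F\<close>, hence
  \<open>card E < card F\<close> and \<open>card F < card E\<close>.
\<close>

lemma bipartite_connected:
  assumes "E \<noteq> {} \<or> F \<noteq> {}"
    and closed: "\<And>i j. 0 < V $ i $ j \<Longrightarrow> i \<in> E \<longleftrightarrow> j \<in> F"
  shows "E = UNIV" "F = UNIV"
proof -
  have comp: "card (- A) + card A = CARD('n)" for A :: "'n set"
    by (metis Compl_partition2 Compl_disjoint2 card_Un_disjoint finite)
  have 1: "E = {} \<or> - F = {} \<or> card E + card (- F) < CARD('n)"
    using positive_entry[of E "- F"] closed by (meson ComplD not_le)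
  have 2: "- E = {} \<or> F = {} \<or> card (- E) + card F < CARD('n)"
    using positive_entry[of "- E" F] closed by (meson ComplD not_le)
  have "\<not> (- E = {} \<and> F = {})" "\<not> (E = {} \<and> - F = {})"
    using positive_entry[of UNIV UNIV] closed by auto
  then have "- E = {} \<and> - F = {}"
    using 1 2 assms(1) comp[of E] comp[of F] by (cases "E = {}"; cases "F = {}") auto
  then show "E = UNIV" "F = UNIV" by blast+
qed

lemma row_positive_entry: obtains j where "0 < V $ i $ j"
  using positive_entry[of "{i}" UNIV] by auto

lemma column_positive_entry: obtains i where "0 < V $ i $ j"
  using positive_entry[of UNIV "{j}"] by auto

lemma mult_vec_pos: "0 < (V *v x) $ i" if "\<And>j. 0 < x $ j"
proof -
  obtain j where j: "0 < V $ i $ j" by (rule row_positive_entry)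
  show ?thesis unfolding matrix_vector_nth
    by (rule sum_pos2[where i=j]) (use j that in \<open>auto intro: less_imp_le nonneg mult_nonneg_nonneg\<close>)
qed

lemma transpose_mult_vec_pos: "0 < (transpose V *v x) $ i" if "\<And>j. 0 < x $ j"
  using fully_indecomposable_profile.mult_vec_pos[OF transpose_profile that] .

lemma mult_vec_nonneg: "0 \<le> (V *v x) $ i" if "\<And>j. 0 \<le> x $ j"
  unfolding matrix_vector_nth by (intro sum_nonneg mult_nonneg_nonneg nonneg that)

text \<open>
  Brouwer's theorem on the probability simplex for the map \<open>x \<mapsto> V x / |V x|\<^sub>1\<close>, which is well defined
  because no column of \<open>V\<close> vanishes. The support of the fixed point is closed under predecessors,
  so irreducibility makes the eigenvector positive.
\<close>

lemma perron_vector: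
  obtains x l where "\<And>i. 0 < x $ i" and "0 < l" and "V *v x = l *\<^sub>R x"
proof -
  define S :: "(real^'n) set" where "S = cbox 0 1 \<inter> {x. (\<Sum>i\<in>UNIV. x $ i) = 1}"
  have S: "x \<in> S \<longleftrightarrow> (\<forall>i. 0 \<le> x $ i) \<and> (\<Sum>i\<in>UNIV. x $ i) = 1" for x
  proof -
    have "x $ i \<le> 1" if "\<forall>i. 0 \<le> x $ i" "(\<Sum>i\<in>UNIV. x $ i) = 1" for i
      using that member_le_sum[of i UNIV "\<lambda>i. x $ i"] by auto
    then show ?thesis by (auto simp: S_def mem_box_cart)
  qed
  have "compact S" unfolding S_def
    by (intro compact_Int_closed compact_cbox closed_Collect_eq continuous_intros)
  moreover have "convex S" unfolding convex_def
    by (simp add: S sum.distrib sum_distrib_left[symmetric])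
  moreover have "S \<noteq> {}"
  proof -
    have "(\<chi> i. 1 / real CARD('n)) \<in> S" by (simp add: S)
    then show ?thesis by blast
  qed
  moreover define N where "N = (\<lambda>x. \<Sum>i\<in>UNIV. (V *v x) $ i)"
  have N: "0 < N x" if "x \<in> S" for x
  proof -
    have x: "\<And>i. 0 \<le> x $ i" using that S by blast
    obtain j where j: "0 < x $ j"
    proof (rule ccontr)
      assume "\<not> thesis"
      then have "x $ j = 0" for j using x[of j] that[of j] by linarith
      then show False using \<open>x \<in> S\<close> S by auto
    qed
    obtain i where i: "0 < V $ i $ j" by (rule column_positive_entry)
    have "0 < (V *v x) $ i" unfolding matrix_vector_nth
      by (rule sum_pos2[where i=j]) (use i j x nonneg in auto)
    then show ?thesis unfolding N_def
      by (intro sum_pos2[where i=i]) (auto intro: mult_vec_nonneg x)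
  qed
  moreover have "continuous_on S (\<lambda>x. (1 / N x) *\<^sub>R (V *v x))"
  proof -
    have "continuous_on S N" unfolding N_def matrix_vector_nth by (intro continuous_intros)
    moreover have "\<forall>x\<in>S. N x \<noteq> 0" using N by (metis less_irrefl)
    ultimately show ?thesis by (intro continuous_intros matrix_vector_mult_linear_continuous_on)
  qed
  moreover have "(\<lambda>x. (1 / N x) *\<^sub>R (V *v x)) \<in> S \<rightarrow> S"
  proof
    fix x assume x: "x \<in> S"
    have "(\<Sum>i\<in>UNIV. ((1 / N x) *\<^sub>R (V *v x)) $ i) = (1 / N x) * N x"
      unfolding N_def sum_distrib_left by (intro sum.cong) auto
    then show "(1 / N x) *\<^sub>R (V *v x) \<in> S"
      using N[OF x] x by (auto simp: S mult_vec_nonneg)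
  qed
  ultimately obtain x where x: "x \<in> S" "(1 / N x) *\<^sub>R (V *v x) = x"
    using brouwer[of S "\<lambda>x. (1 / N x) *\<^sub>R (V *v x)"] by blast
  have eig: "V *v x = N x *\<^sub>R x"
  proof -
    have "N x *\<^sub>R ((1 / N x) *\<^sub>R (V *v x)) = V *v x" using N[OF x(1)] by simp
    then show ?thesis using x(2) by simp
  qed
  have x0: "\<And>i. 0 \<le> x $ i" using x S by blast
  have "{i. 0 < x $ i} = UNIV"
  proof (rule irreducible)
    show "{i. 0 < x $ i} \<noteq> {}"
    proof
      assume "{i. 0 < x $ i} = {}"
      then have "x $ i = 0" for i using x0[of i] by (metis (mono_tags) empty_Collect_eq order_less_le)
      then show False using x S by auto
    qed
    fix i j assume ij: "0 < V $ i $ j" "j \<in> {i. 0 < x $ i}"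
    have "0 < (V *v x) $ i" unfolding matrix_vector_nth
      by (rule sum_pos2[where i=j]) (use ij x0 nonneg in auto)
    then show "i \<in> {i. 0 < x $ i}" using eig N[OF x(1)] by (simp add: zero_less_mult_iff)
  qed
  then show ?thesis using that[of x "N x"] eig N[OF x(1)] by blast
qed

end

text \<open>
  Compare \<open>|v|\<close> with the least multiple of \<open>x\<close> that dominates it, at an index where they touch.
\<close>

lemma complex_eigenvalue_le:
  fixes A :: "real^'n^'n"
  assumes nn: "\<And>i j. 0 \<le> A $ i $ j" and x: "\<And>i. 0 < x $ i" and Ax: "A *v x = l *\<^sub>R x"
    and k: "k \<in> complex_eigenvalues A"
  shows "cmod k \<le> l"
proof -
  obtain v :: "complex^'n" where v: "v \<noteq> 0"
    and kv: "(\<chi> i j. complex_of_real (A $ i $ j)) *v v = k *s v"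
    using k by (auto simp: complex_eigenvalues_def)
  define M where "M = Max (range (\<lambda>i. cmod (v $ i) / x $ i))"
  have M: "cmod (v $ i) \<le> M * x $ i" for i
  proof -
    have "cmod (v $ i) / x $ i \<le> M" unfolding M_def by (rule Max_ge) auto
    then show ?thesis using x[of i] by (simp add: field_simps)
  qed
  have "M \<in> range (\<lambda>i. cmod (v $ i) / x $ i)" unfolding M_def by (intro Max_in) auto
  then obtain i where "M = cmod (v $ i) / x $ i" by blast
  then have i: "cmod (v $ i) = M * x $ i" using x[of i] by simp
  have "M > 0"
  proof -
    obtain j where "v $ j \<noteq> 0" using v by (auto simp: vec_eq_iff)
    then have "0 < M * x $ j" using M[of j] by (smt (verit) zero_less_norm_iff)
    then show ?thesis using x[of j] by (simp add: zero_less_mult_iff)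
  qed
  have "cmod k * (M * x $ i) = cmod ((k *s v) $ i)" by (simp add: norm_mult i)
  also have "\<dots> = cmod (\<Sum>j\<in>UNIV. complex_of_real (A $ i $ j) * v $ j)"
    unfolding kv[symmetric] by (simp add: matrix_vector_mult_def)
  also have "\<dots> \<le> (\<Sum>j\<in>UNIV. A $ i $ j * (M * x $ j))"
    by (rule sum_norm_le) (simp add: norm_mult nn M mult_left_mono)
  also have "\<dots> = M * (A *v x) $ i"
    by (simp add: matrix_vector_nth sum_distrib_left algebra_simps)
  also have "\<dots> = l * (M * x $ i)" by (simp add: Ax)
  finally show ?thesis using \<open>M > 0\<close> x[of i] by simp
qed

lemma real_eigenvalue_in:
  fixes A :: "real^'n^'n"
  assumes "x \<noteq> 0" and Ax: "A *v x = l *\<^sub>R x"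
  shows "complex_of_real l \<in> complex_eigenvalues A"
proof -
  have "(\<Sum>j\<in>UNIV. A $ i $ j * x $ j) = l * x $ i" for i
    using Ax by (metis matrix_vector_nth vector_scaleR_component real_scaleR_def)
  then have "(\<chi> i j. complex_of_real (A $ i $ j)) *v (\<chi> i. complex_of_real (x $ i))
      = complex_of_real l *s (\<chi> i. complex_of_real (x $ i))"
    by (simp add: vec_eq_iff matrix_vector_mult_def flip: of_real_mult of_real_sum)
  moreover have "(\<chi> i. complex_of_real (x $ i)) \<noteq> 0"
    using assms(1) by (auto simp: vec_eq_iff)
  ultimately show ?thesis unfolding complex_eigenvalues_def by blast
qed

text \<open>
  A positive eigenvector identifies the spectral radius. As \<open>spec_radius\<close> is defined by \<open>Max\<close>, the spectrum
  must be known to be finite; it is the root set of the characteristic polynomial, which is not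
  zero since large real numbers are not eigenvalues.
\<close>

lemma spec_radius_eq_perron:
  fixes A :: "real^'n^'n"
  assumes nn: "\<And>i j. 0 \<le> A $ i $ j" and x: "\<And>i. 0 < x $ i" and Ax: "A *v x = l *\<^sub>R x" 
  shows "spec_radius A = l"
proof -
  have x0: "x \<noteq> 0" using x by (metis less_irrefl zero_index)
  define B :: "complex^'n^'n" where "B = (\<chi> i j. complex_of_real (A $ i $ j))"
  define C where "C k = (\<chi> i j. B $ i $ j - (if i = j then k else 0))" for k
  have C: "C k *v v = B *v v - k *s v" for k v
    by (simp add: C_def vec_eq_iff matrix_vector_mult_def left_diff_distrib sum_subtractf
        if_distrib[of "\<lambda>x. x * _"] cong: if_cong)
  define p :: "complex poly" where
    "p = (\<Sum>\<pi> | \<pi> permutes (UNIV::'n set). of_int (sign \<pi>) *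
       (\<Prod>i\<in>UNIV. [: B $ i $ \<pi> i, if i = \<pi> i then - 1 else 0 :]))"
  have p: "poly p k = det (C k)" for k
    unfolding p_def det_def poly_sum poly_mult poly_prod
    by (intro sum.cong prod.cong arg_cong2[where f="(*)"] refl) (auto simp: C_def)
  have root: "k \<in> complex_eigenvalues A \<longleftrightarrow> poly p k = 0" for k
  proof -
    have "k \<in> complex_eigenvalues A \<longleftrightarrow> (\<exists>v. v \<noteq> 0 \<and> C k *v v = 0)"
      by (simp add: complex_eigenvalues_def B_def C)
    also have "\<dots> \<longleftrightarrow> \<not> invertible (C k)"
      by (metis invertible_left_inverse matrix_left_invertible_ker)
    finally show ?thesis unfolding p by (simp add: invertible_det_nz)
  qed
  have "p \<noteq> 0"
  proof
    assume "p = 0"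
    then have "complex_of_real (\<bar>l\<bar> + 1) \<in> complex_eigenvalues A" by (simp add: root)
    from complex_eigenvalue_le[OF nn x Ax this] show False by (simp add: norm_of_real del: of_real_add)
  qed
  then have fin: "finite (complex_eigenvalues A)"
    using root by (auto intro: finite_subset[OF _ poly_roots_finite[of p]])
  have "0 \<le> l"
  proof -
    fix i
    have "0 \<le> (A *v x) $ i"
      unfolding matrix_vector_nth using nn x by (intro sum_nonneg mult_nonneg_nonneg) (auto intro: less_imp_le)
    then show ?thesis using x[of i] by (simp add: Ax zero_le_mult_iff)
  qed
  then have "l \<in> cmod ` complex_eigenvalues A"
    using real_eigenvalue_in[OF x0 Ax] by (metis abs_of_nonneg image_eqI norm_of_real)
  then show ?thesis unfolding spec_radius_def
    by (intro Max_eqI) (use fin complex_eigenvalue_le[OF nn x Ax] in auto)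
qed

section \<open>Sinkhorn scaling of a fully indecomposable profile\<close>

text \<open>
  The counting hypothesis says that the decreasing rearrangement of \<open>z\<close> dominates that of \<open>y\<close>. The
  induction removes a largest element on both sides.
\<close>

lemma prod_le_prod_if_count_le:
  fixes y :: "'a \<Rightarrow> real" and z :: "'b \<Rightarrow> real"
  assumes "finite A" "finite B" "card A = card B"
    and "\<And>j. j \<in> B \<Longrightarrow> 0 \<le> y j"
    and "\<And>t. card {j\<in>B. t \<le> y j} \<le> card {i\<in>A. t \<le> z i}"
  shows "prod y B \<le> prod z A"
  using assms
proof (induction "card B" arbitrary: A B)
  case 0
  then show ?case by simp
next
  case (Suc n)
  have "A \<noteq> {}" "B \<noteq> {}" using Suc by auto
  have "Max (y ` B) \<in> y ` B" using Suc \<open>B \<noteq> {}\<close> by (intro Max_in) auto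
  then obtain j where j: "j \<in> B" "Max (y ` B) = y j" by blast
  then have jmax: "y k \<le> y j" if "k \<in> B" for k using that Suc(4) by (metis Max_ge finite_imageI imageI)
  have "Max (z ` A) \<in> z ` A" using Suc \<open>A \<noteq> {}\<close> by (intro Max_in) auto
  then obtain i where i: "i \<in> A" "Max (z ` A) = z i" by blast
  then have imax: "z k \<le> z i" if "k \<in> A" for k using that Suc(3) by (metis Max_ge finite_imageI imageI)
  have yz: "y j \<le> z i"
  proof -
    have "0 < card {k\<in>B. y j \<le> y k}" using j Suc(4) by (subst card_gt_0_iff) auto
    then have "0 < card {k\<in>A. y j \<le> z k}" using Suc(7)[of "y j"] by linarith
    then obtain k where "k \<in> A" "y j \<le> z k" by (auto simp: card_gt_0_iff)
    then show ?thesis using imax[of k] by linarith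
  qed
  have "prod y (B - {j}) \<le> prod z (A - {i})"
  proof (rule Suc.hyps(1))
    show "n = card (B - {j})" "finite (A - {i})" "finite (B - {j})" "card (A - {i}) = card (B - {j})"
      using Suc i j by auto
    show "0 \<le> y k" if "k \<in> B - {j}" for k using that Suc by auto
    fix t
    show "card {k\<in>B - {j}. t \<le> y k} \<le> card {k\<in>A - {i}. t \<le> z k}"
    proof (cases "t \<le> y j")
      case True
      have "{k\<in>B - {j}. t \<le> y k} = {k\<in>B. t \<le> y k} - {j}" "{k\<in>A - {i}. t \<le> z k} = {k\<in>A. t \<le> z k} - {i}"
        by auto
      then show ?thesis using True yz i j Suc(7)[of t] by simp
    next
      case False
      then have "{k\<in>B - {j}. t \<le> y k} = {}" using jmax by fastforce
      then show ?thesis by (metis card.empty le0)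
    qed
  qed
  then have "y j * prod y (B - {j}) \<le> z i * prod z (A - {i})"
    using yz j Suc.prems(4) order_trans[OF Suc.prems(4)[OF j(1)] yz]
    by (intro mult_mono) (auto intro!: prod_nonneg)
  then show ?case using i j Suc by (simp add: prod.remove)
qed

context fully_indecomposable_profile
begin

text \<open>
  Hall's condition with a surplus of one. The surplus is what makes the scaling potential coercive.
\<close>

lemma neighbours_expand:
  assumes "J \<noteq> {}" "J \<noteq> UNIV"
  shows "card J < card {i. \<exists>j\<in>J. 0 < V $ i $ j}"
proof -
  define N where "N = {i. \<exists>j\<in>J. 0 < V $ i $ j}"
  have comp: "card (- N) + card N = CARD('n)"
    by (metis Compl_partition2 Compl_disjoint2 card_Un_disjoint finite)
  have J: "card J < CARD('n)" by (rule psubset_card_mono) (use assms(2) in auto)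
  have "card J < card N"
  proof (cases "- N = {}")
    case True
    then have "card (- N) = 0" by simp
    then show ?thesis using comp J by linarith
  next
    case False
    have "\<not> CARD('n) \<le> card (- N) + card J"
    proof
      assume "CARD('n) \<le> card (- N) + card J"
      then obtain i j where "i \<in> - N" "j \<in> J" "0 < V $ i $ j"
        using positive_entry[OF False assms(1)] by blast
      then show False by (auto simp: N_def)
    qed
    then show ?thesis using comp by linarith
  qed
  then show ?thesis by (simp add: N_def)
qed

text \<open>
  The factor \<open>y\<^sub>k / y\<^sub>l\<close> comes from the surplus in \<open>neighbours_expand\<close>. The rows adjacent to the
  superlevel set \<open>{j. t \<le> y\<^sub>j}\<close> satisfy \<open>(V y)\<^sub>i \<ge> v t\<close>, and unless the set is empty or everything, there is
  at least one more of them than it has elements. Hence the comparison of products survives when the entry \<open>y\<^sub>l\<close> is raised to \<open>y\<^sub>k\<close>.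
\<close>

lemma prod_mult_vec_lower_bound:
  assumes v: "0 < v" "\<And>i j. 0 < V $ i $ j \<Longrightarrow> v \<le> V $ i $ j" and y: "\<And>j. 0 < y $ j"
  shows "v ^ CARD('n) * (\<Prod>j\<in>UNIV. y $ j) * (y $ k / y $ l) \<le> (\<Prod>i\<in>UNIV. (V *v y) $ i)"
proof -
  define y' where "y' j = (if j = l then y $ k else y $ j)" for j
  have lower: "v * t \<le> (V *v y) $ i" if "0 < V $ i $ j" "t \<le> y $ j" for i j t
  proof -
    have "v * t \<le> V $ i $ j * y $ j"
    proof (cases "0 \<le> t")
      case True
      then show ?thesis using that v(2)[OF that(1)] by (intro mult_mono nonneg) auto
    next
      case False
      then have "v * t \<le> 0" using v by (simp add: mult_le_0_iff)
      also have "\<dots> \<le> V $ i $ j * y $ j" by (simp add: nonneg less_imp_le[OF y])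
      finally show ?thesis .
    qed
    also have "\<dots> \<le> (V *v y) $ i" unfolding matrix_vector_nth
      by (rule member_le_sum[of j UNIV "\<lambda>j. V $ i $ j * y $ j"])
        (simp_all add: nonneg less_imp_le[OF y])
    finally show ?thesis .
  qed
  have "(\<Prod>j\<in>UNIV. y' j) \<le> (\<Prod>i\<in>UNIV. (V *v y) $ i / v)"
  proof (rule prod_le_prod_if_count_le)
    show "0 \<le> y' j" for j by (simp add: y'_def less_imp_le[OF y])
    fix t
    define J where "J = {j. t \<le> y $ j}"
    have "{i. \<exists>j\<in>J. 0 < V $ i $ j} \<subseteq> {i. t \<le> (V *v y) $ i / v}"
      using lower v by (auto simp: J_def field_simps)
    then have N: "card {i. \<exists>j\<in>J. 0 < V $ i $ j} \<le> card {i. t \<le> (V *v y) $ i / v}"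
      by (intro card_mono) auto
    have "card {j. t \<le> y' j} \<le> card {i. \<exists>j\<in>J. 0 < V $ i $ j}"
    proof (cases "J = {} \<or> J = UNIV")
      case True
      then show ?thesis
      proof
        assume "J = {}"
        then have "{j. t \<le> y' j} = {}" by (auto simp: J_def y'_def split: if_splits)
        then show ?thesis by simp
      next
        assume "J = UNIV"
        moreover have "{i. \<exists>j. 0 < V $ i $ j} = UNIV" using row_positive_entry by blast
        ultimately show ?thesis by (simp add: card_mono)
      qed
    next
      case False
      have "{j. t \<le> y' j} \<subseteq> insert l J" by (auto simp: J_def y'_def)
      then have "card {j. t \<le> y' j} \<le> card (insert l J)" by (intro card_mono) auto
      also have "\<dots> \<le> Suc (card J)" by (simp add: card_insert_if)
      also have "\<dots> \<le> card {i. \<exists>j\<in>J. 0 < V $ i $ j}" using neighbours_expand False by (simp add: Suc_le_eq)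
      finally show ?thesis .
    qed
    then show "card {j \<in> UNIV. t \<le> y' j} \<le> card {i \<in> UNIV. t \<le> (V *v y) $ i / v}" using N by simp
  qed auto
  moreover have "(\<Prod>j\<in>UNIV. y' j) = (\<Prod>j\<in>UNIV. y $ j) * (y $ k / y $ l)"
  proof -
    have "(\<Prod>j\<in>UNIV. y' j) = y' l * (\<Prod>j\<in>UNIV - {l}. y' j)" by (intro prod.remove) auto
    also have "(\<Prod>j\<in>UNIV - {l}. y' j) = (\<Prod>j\<in>UNIV - {l}. y $ j)"
      by (intro prod.cong) (auto simp: y'_def)
    finally show ?thesis
      using y[of l] prod.remove[of UNIV l "\<lambda>j. y $ j"] by (simp add: y'_def)
  qed
  ultimately show ?thesis using v by (simp add: prod_dividef field_simps)
qed

text \<open>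
  The potential is invariant under scaling of \<open>y\<close>, so \<open>y\<close> may be normalised to have maximum one. By the
  previous bound it then exceeds its value at the vector \<open>1\<close> as soon as some entry is
  below \<open>e\<close>, so the minimum over a compact box is global.
\<close>

lemma scaling_potential_minimiser:
  obtains y where "\<And>j. 0 < y $ j"
    and "\<And>x. (\<And>j. 0 < x $ j) \<Longrightarrow>
      (\<Prod>i\<in>UNIV. (V *v y) $ i) / (\<Prod>j\<in>UNIV. y $ j) \<le> (\<Prod>i\<in>UNIV. (V *v x) $ i) / (\<Prod>j\<in>UNIV. x $ j)"
proof -
  define P where "P x = (\<Prod>i\<in>UNIV. (V *v x) $ i) / (\<Prod>j\<in>UNIV. x $ j)" for x
  obtain v where v: "0 < v" "\<And>i j. 0 < V $ i $ j \<Longrightarrow> v \<le> V $ i $ j"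
  proof
    let ?S = "insert 1 ((\<lambda>(i,j). V $ i $ j) ` {(i, j). 0 < V $ i $ j})"
    show "0 < Min ?S" by (subst Min_gr_iff) auto
    show "Min ?S \<le> V $ i $ j" if "0 < V $ i $ j" for i j by (rule Min_le) (use that in auto)
  qed
  have bound: "v ^ CARD('n) * (x $ k / x $ l) \<le> P x" if "\<And>j. 0 < x $ j" for x k l
  proof -
    have "0 < (\<Prod>j\<in>UNIV. x $ j)" using that by (intro prod_pos) auto
    then show ?thesis using prod_mult_vec_lower_bound[OF v that, of k l]
      by (simp add: P_def field_simps)
  qed
  define e where "e = min 1 (v ^ CARD('n) / (P 1 + 1))"
  have "0 < P 1" unfolding P_def by (intro divide_pos_pos prod_pos) (auto intro: mult_vec_pos)
  then have e: "0 < e" "e \<le> 1" "e \<le> v ^ CARD('n) / (P 1 + 1)" using v by (auto simp: e_def)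
  define C :: "(real^'n) set" where "C = cbox (\<chi> j. e) 1"
  have C: "x \<in> C \<longleftrightarrow> (\<forall>j. e \<le> x $ j \<and> x $ j \<le> 1)" for x by (simp add: C_def mem_box_cart)
  have "1 \<in> C" using e by (simp add: C)
  moreover have "continuous_on C P"
  proof -
    have "x $ j \<noteq> 0" if "x \<in> C" for x j
      using that e(1) unfolding C by (metis less_le_not_le)
    then have "\<forall>x\<in>C. (\<Prod>j\<in>UNIV. x $ j) \<noteq> 0" by simp
    then show ?thesis unfolding P_def matrix_vector_nth by (intro continuous_intros)
  qed
  ultimately obtain y where y: "y \<in> C" "\<And>x. x \<in> C \<Longrightarrow> P y \<le> P x"
    using continuous_attains_inf[of C P] by (auto simp: C_def)
  show ?thesis
  proof (rule that[of y])
    show "0 < y $ j" for j using y(1) e unfolding C by (meson less_le_trans)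
    fix x :: "real^'n" assume x: "\<And>j. 0 < x $ j"
    define m where "m = Max (range (\<lambda>j. x $ j))"
    have "m \<in> range (\<lambda>j. x $ j)" unfolding m_def by (intro Max_in) auto
    then obtain k where k: "x $ k = m" by auto
    have le: "x $ j \<le> m" for j unfolding m_def by (intro Max_ge) auto
    have m: "0 < m" using x[of k] k by simp
    define w where "w = (1 / m) *\<^sub>R x"
    have w: "0 < w $ j" "w $ j \<le> 1" for j using x[of j] le[of j] m by (auto simp: w_def)
    have wk: "w $ k = 1" using k m by (simp add: w_def)
    have Pw: "P w = P x"
    proof -
      have *: "(\<Prod>i\<in>UNIV. (V *v w) $ i) = (1/m)^CARD('n) * (\<Prod>i\<in>UNIV. (V *v x) $ i)"
        by (simp add: w_def matrix_vector_mult_scaleR prod.distrib prod_dividef power_one_over)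
      have **: "(\<Prod>j\<in>UNIV. w $ j) = (1/m)^CARD('n) * (\<Prod>j\<in>UNIV. x $ j)"
        by (simp add: w_def prod.distrib prod_dividef power_one_over)
      show ?thesis unfolding P_def * ** using m by simp
    qed
    have "P y \<le> P w"
    proof (cases "w \<in> C")
      case True
      then show ?thesis using y by blast
    next
      case False
      then obtain l where l: "w $ l < e" using w by (auto simp: C not_le)
      then have "w $ l \<le> v ^ CARD('n) / (P 1 + 1)" using e by simp
      then have "P 1 + 1 \<le> v ^ CARD('n) * (w $ k / w $ l)"
        using w(1)[of l] \<open>0 < P 1\<close> by (simp add: wk field_simps)
      also have "\<dots> \<le> P w" by (rule bound) (rule w)
      finally show ?thesis using y(2)[OF \<open>1 \<in> C\<close>] by simp
    qed
    then show "(\<Prod>i\<in>UNIV. (V *v y) $ i) / (\<Prod>j\<in>UNIV. y $ j) \<le> (\<Prod>i\<in>UNIV. (V *v x) $ i) / (\<Prod>j\<in>UNIV. x $ j)"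
      unfolding Pw unfolding P_def .
  qed
qed

text \<open>
  Criticality of the potential at its minimiser \<open>y\<close> reads \<open>\<Sum>\<^sub>i V\<^sub>i\<^sub>j / (V y)\<^sub>i = 1 / y\<^sub>j\<close>. Hence
  \<open>1 / (V y)\<close> and \<open>y\<close> scale \<open>V\<close> to unit row and column sums, and the remaining freedom
  \<open>(\<lambda> p, p' / \<lambda>)\<close> is used to balance the totals as in the master equations.
\<close>

lemma sinkhorn_scaling:
  obtains p p' where "\<And>i. 0 < p $ i" "\<And>i. 0 < p' $ i"
    "\<And>i. p $ i * (V *v p') $ i = 1" "\<And>i. p' $ i * (transpose V *v p) $ i = 1"
    "(\<Sum>i\<in>UNIV. p $ i) = (\<Sum>i\<in>UNIV. p' $ i)"
proof -
  obtain y where y: "\<And>j. 0 < y $ j"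
    and ymin: "\<And>x. (\<And>j. 0 < x $ j) \<Longrightarrow>
      (\<Prod>i\<in>UNIV. (V *v y) $ i) / (\<Prod>j\<in>UNIV. y $ j) \<le> (\<Prod>i\<in>UNIV. (V *v x) $ i) / (\<Prod>j\<in>UNIV. x $ j)"
    by (rule scaling_potential_minimiser) blast
  define z where "z i = (V *v y) $ i" for i
  have z: "0 < z i" for i unfolding z_def by (rule mult_vec_pos) (rule y)
  have crit: "(\<Sum>i\<in>UNIV. V $ i $ j / z i) = 1 / y $ j" for j
  proof -
    define h where "h t = (\<Sum>i\<in>UNIV. ln (z i + t * V $ i $ j)) - ln (y $ j + t)
       - (\<Sum>k\<in>UNIV - {j}. ln (y $ k))" for t
    have "(h has_real_derivative (\<Sum>i\<in>UNIV. V $ i $ j / z i) - 1 / y $ j) (at 0)"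
      unfolding h_def using z y[of j]
      by (auto intro!: derivative_eq_intros sum.cong simp: field_simps less_imp_neq[OF z, symmetric])
    moreover have "h 0 \<le> h t" if t: "\<bar>0 - t\<bar> < y $ j" for t
    proof -
      define x where "x = y + t *\<^sub>R axis j 1"
      have x: "0 < x $ k" for k using t y[of k] by (auto simp: x_def axis_def)
      have Vx: "(V *v x) $ i = z i + t * V $ i $ j" for i
        by (simp add: x_def matrix_vector_right_distrib z_def matrix_vector_mult_scaleR
            matrix_vector_mult_basis column_def)
      have h: "ln ((\<Prod>i\<in>UNIV. (V *v w) $ i) / (\<Prod>k\<in>UNIV. w $ k)) =
          (\<Sum>i\<in>UNIV. ln ((V *v w) $ i)) - ln (w $ j) - (\<Sum>k\<in>UNIV - {j}. ln (w $ k))"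
        if w: "\<And>k. 0 < w $ k" for w
      proof -
        have "ln ((\<Prod>i\<in>UNIV. (V *v w) $ i) / (\<Prod>k\<in>UNIV. w $ k)) =
            (\<Sum>i\<in>UNIV. ln ((V *v w) $ i)) - (\<Sum>k\<in>UNIV. ln (w $ k))"
          using w mult_vec_pos[of w] by (simp add: ln_div prod_pos ln_prod less_imp_neq[symmetric])
        then show ?thesis by (simp add: sum.remove[of UNIV j])
      qed
      have pos: "0 < (\<Prod>i\<in>UNIV. (V *v w) $ i) / (\<Prod>k\<in>UNIV. w $ k)" if "\<And>k. 0 < w $ k" for w
        using that mult_vec_pos[of w] by (intro divide_pos_pos prod_pos) auto
      have "h 0 = ln ((\<Prod>i\<in>UNIV. (V *v y) $ i) / (\<Prod>k\<in>UNIV. y $ k))"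
        by (subst h[OF y]) (simp add: h_def z_def)
      also have "\<dots> \<le> ln ((\<Prod>i\<in>UNIV. (V *v x) $ i) / (\<Prod>k\<in>UNIV. x $ k))"
        using ymin[OF x] pos[of x] pos[of y] x y by (subst ln_le_cancel_iff) auto
      also have "\<dots> = h t"
      proof -
        have "(\<Sum>k\<in>UNIV - {j}. ln (x $ k)) = (\<Sum>k\<in>UNIV - {j}. ln (y $ k))"
          by (intro sum.cong) (auto simp: x_def axis_def)
        moreover have "x $ j = y $ j + t" by (simp add: x_def)
        ultimately show ?thesis by (subst h[OF x]) (simp add: Vx h_def)
      qed
      finally show ?thesis .
    qed
    ultimately have "(\<Sum>i\<in>UNIV. V $ i $ j / z i) - 1 / y $ j = 0"
      using DERIV_local_min[of h _ 0 "y $ j"] y[of j] by blast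
    then show ?thesis by simp
  qed
  define a where "a = (\<Sum>i\<in>UNIV. 1 / z i)"
  define b where "b = (\<Sum>j\<in>UNIV. y $ j)"
  define c where "c = sqrt (b / a)"
  have "0 < a" unfolding a_def using z by (intro sum_pos) auto
  moreover have "0 < b" unfolding b_def using y by (intro sum_pos) auto
  ultimately have c: "0 < c" "c * c = b / a" by (auto simp: c_def)
  show ?thesis
  proof (rule that[of "\<chi> i. c / z i" "(1 / c) *\<^sub>R y"])
    show "0 < (\<chi> i. c / z i) $ i" for i using z c by simp
    show "0 < ((1 / c) *\<^sub>R y) $ i" for i using y c by simp
    show "(\<chi> i. c / z i) $ i * (V *v (1 / c) *\<^sub>R y) $ i = 1" for i
      using c z[of i] by (simp add: matrix_vector_mult_scaleR flip: z_def)
    show "((1 / c) *\<^sub>R y) $ i * (transpose V *v (\<chi> i. c / z i)) $ i = 1" for i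
    proof -
      have "(transpose V *v (\<chi> i. c / z i)) $ i = c * (\<Sum>k\<in>UNIV. V $ k $ i / z k)"
        unfolding transpose_vector_nth sum_distrib_left by (intro sum.cong) auto
      then show ?thesis using c y[of i] crit by simp
    qed
    have "(\<Sum>i\<in>UNIV. (\<chi> i. c / z i) $ i) = c * a" by (simp add: a_def sum_distrib_left)
    also have "\<dots> = b / c" using c \<open>0 < a\<close> by (simp add: field_simps)
    also have "\<dots> = (\<Sum>i\<in>UNIV. ((1 / c) *\<^sub>R y) $ i)" by (simp add: b_def sum_divide_distrib)
    finally show "(\<Sum>i\<in>UNIV. (\<chi> i. c / z i) $ i) = (\<Sum>i\<in>UNIV. ((1 / c) *\<^sub>R y) $ i)" .
  qed
qed

end

section \<open>Uniqueness for the master equations and the scaling inequality\<close>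

text \<open>
  Keeps \<open>transpose V *v q\<close> in the form in which the master equations state it.
\<close>

declare transpose_matrix_vector [simp del]

lemma sum_nonneg_eq_0_D:
  fixes f :: "'a::finite \<Rightarrow> real"
  assumes "\<And>i. 0 \<le> f i" "(\<Sum>i\<in>UNIV. f i) = 0"
  shows "f i = 0"
  using sum_nonneg_eq_0_iff[of UNIV f] assms by simp

lemma inner_mult_vec_transpose:
  fixes A :: "real^'n^'n"
  shows "(\<Sum>i\<in>UNIV. x $ i * (A *v y) $ i) = (\<Sum>j\<in>UNIV. y $ j * (transpose A *v x) $ j)"
  unfolding matrix_vector_nth transpose_vector_nth sum_distrib_left
  by (subst sum.swap) (simp add: transpose_def ac_simps)

context fully_indecomposable_profile
begin

lemma mult_vec_pos_if: "0 < (V *v x) $ i" if "\<And>j. 0 \<le> x $ j" "0 < V $ i $ j" "0 < x $ j"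
  unfolding matrix_vector_nth
  by (rule sum_pos2[where i=j]) (simp_all add: that nonneg)

lemma transpose_mult_vec_pos_if:
  "0 < (transpose V *v x) $ j" if "\<And>i. 0 \<le> x $ i" "0 < V $ i $ j" "0 < x $ i"
  unfolding transpose_vector_nth
  by (rule sum_pos2[where i=i]) (simp_all add: that nonneg)

lemma transpose_mult_vec_nonneg: "0 \<le> (transpose V *v x) $ i" if "\<And>j. 0 \<le> x $ j"
  unfolding transpose_vector_nth by (intro sum_nonneg mult_nonneg_nonneg nonneg that)

text \<open>
  The support of \<open>q\<close> is closed under \<open>V\<^sup>T\<close> and that of \<open>q'\<close> under \<open>V\<close>. The balance of the totals is needed
  to exclude that just one of the two vectors vanishes.
\<close>

lemma master_solution_pos:
  assumes s: "0 < s" and M: "master_equations V s q q'" and nz: "(q, q') \<noteq> (0, 0)"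
  shows "0 < q $ i" "0 < q' $ i"
proof -
  define a where "a = V *v q'"
  define b where "b = transpose V *v q"
  have q: "q $ i = b $ i / (s\<^sup>2 + a $ i * b $ i)" "q' $ i = a $ i / (s\<^sup>2 + a $ i * b $ i)"
    and q0: "0 \<le> q $ i" "0 \<le> q' $ i" for i
    using M by (auto simp: master_equations_def a_def b_def)
  have sums: "(\<Sum>i\<in>UNIV. q $ i) = (\<Sum>i\<in>UNIV. q' $ i)" using M by (auto simp: master_equations_def)
  have ab: "0 \<le> a $ i" "0 \<le> b $ i" for i
    using q0 by (auto simp: a_def b_def intro: mult_vec_nonneg transpose_mult_vec_nonneg)
  have den: "0 < s\<^sup>2 + a $ i * b $ i" for i using s ab[of i] by (simp add: add_pos_nonneg)
  have zero: "w = 0" if "\<And>i. 0 \<le> w $ i" "(\<Sum>i\<in>UNIV. w $ i) = 0" for w :: "real^'n"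
    unfolding vec_eq_iff zero_index using sum_nonneg_eq_0_D[of "\<lambda>i. w $ i"] that by blast
  have "q \<noteq> 0"
    using nz zero[of q'] q0(2) sums by auto
  moreover have "q' \<noteq> 0"
    using nz zero[of q] q0(1) sums by auto
  ultimately obtain k k' where "q $ k \<noteq> 0" "q' $ k' \<noteq> 0" by (auto simp: vec_eq_iff)
  then have k: "0 < q $ k" "0 < q' $ k'" using q0(1)[of k] q0(2)[of k'] by auto
  have "{i. 0 < q $ i} = UNIV"
  proof (rule fully_indecomposable_profile.irreducible[OF transpose_profile])
    show "{i. 0 < q $ i} \<noteq> {}" using k by blast
    fix i j assume "0 < transpose V $ i $ j" "j \<in> {i. 0 < q $ i}"
    then have "0 < b $ i" unfolding b_def
      by (intro transpose_mult_vec_pos_if[where i=j] q0) (auto simp: transpose_def)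
    then show "i \<in> {i. 0 < q $ i}" using den[of i] by (simp add: q(1))
  qed
  moreover have "{i. 0 < q' $ i} = UNIV"
  proof (rule irreducible)
    show "{i. 0 < q' $ i} \<noteq> {}" using k by blast
    fix i j assume "0 < V $ i $ j" "j \<in> {i. 0 < q' $ i}"
    then have "0 < a $ i" unfolding a_def by (intro mult_vec_pos_if[where j=j] q0) auto
    then show "i \<in> {i. 0 < q' $ i}" using den[of i] by (simp add: q(2))
  qed
  ultimately show "0 < q $ i" "0 < q' $ i" by blast+
qed

text \<open>
  The map \<open>(q, q') \<mapsto> (b / (s\<^sup>2 + a b), a / (s\<^sup>2 + a b))\<close> is increasing for the order in which the first
  vector goes up and the second one down, and it commutes with \<open>(q, q') \<mapsto> (c q, q' / c)\<close>. Compare two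
  solutions by the least \<open>c\<close> with \<open>r \<le> c q\<close> and \<open>q' \<le> c r'\<close>: at an index where one of these is an
  equality, strict monotonicity makes both \<open>a\<close> and \<open>b\<close> tight, so equality spreads along the
  edges of \<open>V\<close>. The solutions therefore differ by the scaling \<open>c\<close>, and the balance of the totals
  gives \<open>c = 1\<close>.
\<close>

lemma master_solution_unique:
  assumes s: "0 < s"
    and M: "master_equations V s q q'" "(q, q') \<noteq> (0, 0)"
    and N: "master_equations V s r r'" "(r, r') \<noteq> (0, 0)"
  shows "(r, r') = (q, q')"
proof -
  define a where "a = V *v q'"
  define b where "b = transpose V *v q"
  define \<alpha> where "\<alpha> = V *v r'"
  define \<beta> where "\<beta> = transpose V *v r"
  have qpos: "0 < q $ i" "0 < q' $ i" and rpos: "0 < r $ i" "0 < r' $ i" for i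
    using master_solution_pos[OF s M] master_solution_pos[OF s N] by auto
  have q: "q $ i = b $ i / (s\<^sup>2 + a $ i * b $ i)" "q' $ i = a $ i / (s\<^sup>2 + a $ i * b $ i)"
    and r: "r $ i = \<beta> $ i / (s\<^sup>2 + \<alpha> $ i * \<beta> $ i)" "r' $ i = \<alpha> $ i / (s\<^sup>2 + \<alpha> $ i * \<beta> $ i)" for i
    using M(1) N(1) by (auto simp: master_equations_def a_def b_def \<alpha>_def \<beta>_def)
  have pos: "0 < a $ i" "0 < b $ i" "0 < \<alpha> $ i" "0 < \<beta> $ i" for i
    using qpos rpos by (auto simp: a_def b_def \<alpha>_def \<beta>_def intro: mult_vec_pos transpose_mult_vec_pos)
  have den: "0 < s\<^sup>2 + a $ i * b $ i" "0 < s\<^sup>2 + \<alpha> $ i * \<beta> $ i" for i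
    using s pos[of i] by (simp_all add: add_pos_pos)
  define R where "R = range (\<lambda>i. r $ i / q $ i) \<union> range (\<lambda>i. q' $ i / r' $ i)"
  define c where "c = Max R"
  have cR: "c \<in> R" unfolding c_def by (rule Max_in) (auto simp: R_def)
  have c_ge: "x \<le> c" if "x \<in> R" for x using that unfolding c_def by (intro Max_ge) (auto simp: R_def)
  have rq: "r $ i \<le> c * q $ i" for i
    using c_ge[of "r $ i / q $ i"] qpos[of i] by (auto simp: R_def field_simps)
  have qr: "q' $ i \<le> c * r' $ i" for i
    using c_ge[of "q' $ i / r' $ i"] rpos[of i] by (auto simp: R_def field_simps)
  have c: "0 < c"
  proof -
    fix i
    have "0 < c * q $ i" using rq[of i] rpos(1)[of i] by linarith
    then show ?thesis using qpos(1)[of i] by (simp add: zero_less_mult_iff)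
  qed
  define E where "E = {i. r $ i = c * q $ i}"
  define F where "F = {i. q' $ i = c * r' $ i}"
  have ne: "E \<union> F \<noteq> {}"
  proof -
    from cR consider i where "c = r $ i / q $ i" | i where "c = q' $ i / r' $ i"
      unfolding R_def by blast
    then show ?thesis
    proof cases
      case (1 i)
      then have "i \<in> E" using qpos[of i] by (simp add: E_def)
      then show ?thesis by blast
    next
      case (2 i)
      then have "i \<in> F" using rpos[of i] by (simp add: F_def)
      then show ?thesis by blast
    qed
  qed
  have b_diff: "c * b $ j - \<beta> $ j = (\<Sum>i\<in>UNIV. V $ i $ j * (c * q $ i - r $ i))" for j
    by (simp add: b_def \<beta>_def transpose_vector_nth sum_distrib_left right_diff_distrib
        sum_subtractf algebra_simps)
  have a_diff: "c * \<alpha> $ i - a $ i = (\<Sum>j\<in>UNIV. V $ i $ j * (c * r' $ j - q' $ j))" for i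
    by (simp add: a_def \<alpha>_def matrix_vector_nth sum_distrib_left right_diff_distrib
        sum_subtractf algebra_simps)
  have b_le: "0 \<le> c * b $ j - \<beta> $ j" for j
    unfolding b_diff using rq by (intro sum_nonneg mult_nonneg_nonneg nonneg) auto
  have a_le: "0 \<le> c * \<alpha> $ i - a $ i" for i
    unfolding a_diff using qr by (intro sum_nonneg mult_nonneg_nonneg nonneg) auto
  \<comment> \<open>Both defects are nonnegative, and the equations at a contact index say that a combination
    of them with positive coefficients vanishes.\<close>
  have tight: "c * b $ i - \<beta> $ i = 0 \<and> c * \<alpha> $ i - a $ i = 0" if "i \<in> E \<union> F" for i
  proof -
    have *: "x = 0 \<and> y = 0" if "0 \<le> x" "0 \<le> y" "0 < u" "0 < v" "u * x + v * y = 0" for u v x y :: real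
      using that by (smt (verit) mult_pos_pos mult_nonneg_nonneg)
    from that consider "i \<in> E" | "i \<in> F" by blast
    then show ?thesis
    proof cases
      case 1
      then have "\<beta> $ i / (s\<^sup>2 + \<alpha> $ i * \<beta> $ i) = c * (b $ i / (s\<^sup>2 + a $ i * b $ i))"
        unfolding q(1)[symmetric] r(1)[symmetric] by (simp add: E_def)
      then have "s\<^sup>2 * (c * b $ i - \<beta> $ i) + (b $ i * \<beta> $ i) * (c * \<alpha> $ i - a $ i) = 0"
        using den[of i] by (simp add: divide_simps split: if_splits) (simp add: algebra_simps)
      then show ?thesis using *[OF b_le a_le] s pos[of i] by (metis mult_pos_pos zero_less_power)
    next
      case 2
      then have "a $ i / (s\<^sup>2 + a $ i * b $ i) = c * (\<alpha> $ i / (s\<^sup>2 + \<alpha> $ i * \<beta> $ i))"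
        unfolding q(2)[symmetric] r(2)[symmetric] by (simp add: F_def)
      then have "s\<^sup>2 * (c * \<alpha> $ i - a $ i) + (a $ i * \<alpha> $ i) * (c * b $ i - \<beta> $ i) = 0"
        using den[of i] by (simp add: divide_simps split: if_splits) (simp add: algebra_simps)
      then show ?thesis using *[OF a_le b_le] s pos[of i] by (metis mult_pos_pos zero_less_power)
    qed
  qed
  have spread_E: "i \<in> E" if "j \<in> E \<union> F" "0 < V $ i $ j" for i j
  proof -
    have "(\<Sum>i\<in>UNIV. V $ i $ j * (c * q $ i - r $ i)) = 0" using tight[OF that(1)] b_diff by simp
    then have "V $ i $ j * (c * q $ i - r $ i) = 0"
      by (rule sum_nonneg_eq_0_D[rotated]) (use rq nonneg in auto)
    then show ?thesis using that by (simp add: E_def)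
  qed
  have spread_F: "j \<in> F" if "i \<in> E \<union> F" "0 < V $ i $ j" for i j
  proof -
    have "(\<Sum>j\<in>UNIV. V $ i $ j * (c * r' $ j - q' $ j)) = 0" using tight[OF that(1)] a_diff by simp
    then have "V $ i $ j * (c * r' $ j - q' $ j) = 0"
      by (rule sum_nonneg_eq_0_D[rotated]) (use qr nonneg in auto)
    then show ?thesis using that by (simp add: F_def)
  qed
  have all: "E \<union> F = UNIV" by (rule irreducible[OF ne]) (use spread_E in blast)
  have E: "r $ i = c * q $ i" for i
  proof -
    obtain j where "0 < V $ i $ j" by (rule row_positive_entry)
    then have "i \<in> E" using spread_E[of j i] all by blast
    then show ?thesis by (simp add: E_def)
  qed
  have F: "q' $ j = c * r' $ j" for j
  proof -
    obtain i where "0 < V $ i $ j" by (rule column_positive_entry)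
    then have "j \<in> F" using spread_F[of i j] all by blast
    then show ?thesis by (simp add: F_def)
  qed
  have "(\<Sum>i\<in>UNIV. q $ i) = (\<Sum>i\<in>UNIV. q' $ i)" "(\<Sum>i\<in>UNIV. r $ i) = (\<Sum>i\<in>UNIV. r' $ i)"
    using M N by (auto simp: master_equations_def)
  moreover have "(\<Sum>i\<in>UNIV. r $ i) = c * (\<Sum>i\<in>UNIV. q $ i)" "(\<Sum>i\<in>UNIV. q' $ i) = c * (\<Sum>i\<in>UNIV. r' $ i)"
    by (simp_all add: E F sum_distrib_left)
  moreover have "0 < (\<Sum>i\<in>UNIV. q $ i)" using qpos by (intro sum_pos) auto
  ultimately have "c * c = 1" by (smt (verit) mult.assoc mult_cancel_right1)
  then have "c = 1" using c by (metis abs_of_pos abs_mult_self_eq mult_cancel_left2 real_sqrt_abs2 real_sqrt_one)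
  then show ?thesis using E F by (simp add: vec_eq_iff)
qed

lemma master_solution_eqI:
  assumes "0 < s" "s < sqrt (spec_radius V)" "master_equations V s q q'" "(q, q') \<noteq> (0, 0)"
  shows "master_solution V s = (q, q')"
proof -
  have "(THE p. master_equations V s (fst p) (snd p) \<and> p \<noteq> (0, 0)) = (q, q')"
  proof (rule the_equality)
    show "master_equations V s (fst (q, q')) (snd (q, q')) \<and> (q, q') \<noteq> (0, 0)"
      using assms(3,4) by simp
    show "p = (q, q')" if "master_equations V s (fst p) (snd p) \<and> p \<noteq> (0, 0)" for p
      using master_solution_unique[OF assms(1,3,4), of "fst p" "snd p"] that by simp
  qed
  then show ?thesis unfolding master_solution_def if_P[OF assms(2)] .
qed

text \<open>
  Jensen's inequality in the form \<open>u - 1 - ln u \<ge> 0\<close>, weighted by the matrix \<open>S\<close> with unit row and column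
  sums, applied to \<open>u = y\<^sub>j / y\<^sub>i\<close> with \<open>y = x / p'\<close>. In the case of equality every weighted defect \<open>g i j\<close>
  vanishes, and irreducibility makes \<open>y\<close> constant.
\<close>

lemma scaled_sum_ge:
  assumes p: "\<And>i. 0 < p $ i" "\<And>i. 0 < p' $ i"
    and rows: "\<And>i. p $ i * (V *v p') $ i = 1" and cols: "\<And>i. p' $ i * (transpose V *v p) $ i = 1"
    and x: "\<And>i. 0 < x $ i" and eig: "V *v x = l *\<^sub>R x"
  shows "real CARD('n) \<le> l * (\<Sum>i\<in>UNIV. p $ i * p' $ i)"
    and "real CARD('n) = l * (\<Sum>i\<in>UNIV. p $ i * p' $ i) \<Longrightarrow> l * p $ i * p' $ i = 1"
proof -
  define S where "S i j = p $ i * V $ i $ j * p' $ j" for i j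
  define y where "y i = x $ i / p' $ i" for i
  have p_ne: "p $ i \<noteq> 0" "p' $ i \<noteq> 0" for i using p(1)[of i] p(2)[of i] by auto
  have y: "0 < y i" for i using x p by (simp add: y_def)
  have S: "0 \<le> S i j" for i j
    by (simp add: S_def nonneg less_imp_le[OF p(1)] less_imp_le[OF p(2)])
  have row: "(\<Sum>j\<in>UNIV. S i j) = 1" for i
    using rows[of i] by (simp add: S_def matrix_vector_nth sum_distrib_left mult.assoc)
  have col: "(\<Sum>i\<in>UNIV. S i j) = 1" for j
    using cols[of j] by (simp add: S_def transpose_vector_nth sum_distrib_left ac_simps)
  have Sy: "(\<Sum>j\<in>UNIV. S i j * (y j / y i)) = l * p $ i * p' $ i" for i
  proof -
    have "(\<Sum>j\<in>UNIV. S i j * (y j / y i)) = p $ i / y i * (V *v x) $ i"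
      unfolding matrix_vector_nth sum_distrib_left
      by (intro sum.cong refl) (simp add: S_def y_def p_ne)
    also have "\<dots> = l * p $ i * p' $ i"
      using x[of i] p(2)[of i] by (simp add: eig y_def)
    finally show ?thesis .
  qed
  define g where "g i j = S i j * (y j / y i - 1 - ln (y j / y i))" for i j
  have g: "0 \<le> g i j" for i j
    unfolding g_def using ln_le_minus_one[of "y j / y i"] y[of i] y[of j]
    by (intro mult_nonneg_nonneg S) simp
  have log: "(\<Sum>i\<in>UNIV. \<Sum>j\<in>UNIV. S i j * ln (y j / y i)) = 0"
  proof -
    have "(\<Sum>i\<in>UNIV. \<Sum>j\<in>UNIV. S i j * ln (y j / y i)) =
        (\<Sum>i\<in>UNIV. \<Sum>j\<in>UNIV. S i j * ln (y j)) - (\<Sum>i\<in>UNIV. \<Sum>j\<in>UNIV. S i j * ln (y i))"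
    proof -
      have "ln (y j / y i) = ln (y j) - ln (y i)" for i j using y[of i] y[of j] by (simp add: ln_div)
      then show ?thesis by (simp only: right_diff_distrib sum_subtractf)
    qed
    also have "(\<Sum>i\<in>UNIV. \<Sum>j\<in>UNIV. S i j * ln (y j)) = (\<Sum>j\<in>UNIV. ln (y j))"
      by (subst sum.swap) (simp add: col flip: sum_distrib_right)
    also have "(\<Sum>i\<in>UNIV. \<Sum>j\<in>UNIV. S i j * ln (y i)) = (\<Sum>i\<in>UNIV. ln (y i))"
      by (simp add: row flip: sum_distrib_right)
    finally show ?thesis by simp
  qed
  have tot: "(\<Sum>i\<in>UNIV. \<Sum>j\<in>UNIV. g i j) = l * (\<Sum>i\<in>UNIV. p $ i * p' $ i) - real CARD('n)"
  proof -
    have "(\<Sum>i\<in>UNIV. \<Sum>j\<in>UNIV. g i j) = (\<Sum>i\<in>UNIV. \<Sum>j\<in>UNIV. S i j * (y j / y i))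
        - (\<Sum>i\<in>UNIV. \<Sum>j\<in>UNIV. S i j) - (\<Sum>i\<in>UNIV. \<Sum>j\<in>UNIV. S i j * ln (y j / y i))"
      by (simp only: g_def right_diff_distrib sum_subtractf mult_1_right)
    then show ?thesis unfolding log Sy row sum_distrib_left by (simp add: mult.assoc)
  qed
  have "0 \<le> (\<Sum>i\<in>UNIV. \<Sum>j\<in>UNIV. g i j)" by (intro sum_nonneg g)
  then show "real CARD('n) \<le> l * (\<Sum>i\<in>UNIV. p $ i * p' $ i)" using tot by simp
  assume "real CARD('n) = l * (\<Sum>i\<in>UNIV. p $ i * p' $ i)"
  then have "(\<Sum>i\<in>UNIV. \<Sum>j\<in>UNIV. g i j) = 0" using tot by simp
  then have "(\<Sum>j\<in>UNIV. g i j) = 0" for i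
    by (rule sum_nonneg_eq_0_D[rotated]) (intro sum_nonneg g)
  then have g0: "g i j = 0" for i j
    by (rule sum_nonneg_eq_0_D[rotated]) (rule g)
  have const: "y j = y i" if "0 < V $ i $ j" for i j
  proof -
    have "S i j \<noteq> 0" using that p(1)[of i] p(2)[of j] by (simp add: S_def)
    then have "ln (y j / y i) = y j / y i - 1" using g0[of i j] by (simp add: g_def)
    then have "y j / y i = 1" using y by (intro ln_eq_minus_one) auto
    then show ?thesis using y[of i] by simp
  qed
  have y_const: "y j = y i" for j
  proof -
    have "{k. y k = y i} = UNIV"
    proof (rule irreducible)
      show "{k. y k = y i} \<noteq> {}" by blast
      show "j \<in> {k. y k = y i}" if "0 < V $ j $ k" "k \<in> {k. y k = y i}" for j k
        using const[OF that(1)] that(2) by simp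
    qed
    then show ?thesis by blast
  qed
  have "y j / y i = 1" for j using y_const[of j] y[of i] by simp
  then have "(\<Sum>j\<in>UNIV. S i j * (y j / y i)) = (\<Sum>j\<in>UNIV. S i j)"
    by (simp only: mult_1_right)
  then show "l * p $ i * p' $ i = 1" using Sy row by simp
qed

end

section \<open>The density at the origin\<close>

lemma has_derivative_vec_lambda:
  fixes g :: "'a::real_normed_vector \<Rightarrow> 'n::finite \<Rightarrow> real"
  assumes "\<And>i. ((\<lambda>x. g x i) has_derivative (\<lambda>h. g' h i)) (at x)"
  shows "((\<lambda>x. \<chi> i. g x i) has_derivative (\<lambda>h. \<chi> i. g' h i)) (at x)"
proof -
  have "((\<lambda>x. \<chi> i. g x i) has_derivative (\<lambda>h. \<chi> i. g' h i)) (at x within UNIV)"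
    by (subst has_derivative_componentwise_within) (auto simp: Basis_vec_def inner_axis assms)
  then show ?thesis by simp
qed

text \<open>
  The inverse function theorem along a line of values, with continuity of the velocity at the base
  point. The continuity is what turns differentiability of the solution curve into a limit of
  derivatives.
\<close>

lemma smooth_preimage_of_line:
  fixes f :: "'a::euclidean_space \<Rightarrow> 'a"
  assumes D: "\<And>x. (f has_derivative D x) (at x)"
    and cont: "\<And>h. continuous_on UNIV (\<lambda>x. D x h)"
    and inj: "\<And>h. D x0 h = 0 \<Longrightarrow> h = 0"
  obtains e \<gamma> \<gamma>' where "0 < e" "\<gamma> 0 = x0"
    "\<And>t. \<bar>t\<bar> < e \<Longrightarrow> f (\<gamma> t) = f x0 + t *\<^sub>R v"
    "\<And>t. \<bar>t\<bar> < e \<Longrightarrow> (\<gamma> has_vector_derivative \<gamma>' t) (at t)"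
    "(\<gamma>' \<longlongrightarrow> \<gamma>' 0) (at 0)"
proof -
  define F where "F x = Blinfun (D x)" for x
  have F: "blinfun_apply (F x) = D x" for x
    unfolding F_def by (rule bounded_linear_Blinfun_apply) (rule has_derivative_bounded_linear[OF D])
  have contF: "continuous_on UNIV F"
    by (rule continuous_on_blinfun_componentwise) (simp add: F cont)
  have linD: "linear (D x)" for x by (rule has_derivative_linear[OF D])
  have "inj (D x0)" using linD inj by (simp add: linear_injective_0)
  then obtain L where L: "linear L" "L \<circ> D x0 = id"
    using linear_injective_left_inverse[OF linD] by blast
  define G where "G = Blinfun L"
  have G: "blinfun_apply G = L" unfolding G_def
    by (rule bounded_linear_Blinfun_apply) (simp add: L linear_linear)
  have GF: "G o\<^sub>L F x0 = id_blinfun"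
    by (rule blinfun_eqI) (use L(2) in \<open>simp add: G F o_def fun_eq_iff\<close>)
  have LD: "L (D x0 h) = h" for h using L(2) by (simp add: o_def fun_eq_iff)
  have derF: "(f has_derivative blinfun_apply (F x)) (at x)" for x by (simp add: F D)
  obtain U V g g' where V: "open V" "f x0 \<in> V" and U: "x0 \<in> U" and hom: "homeomorphism U V f g"
    and g': "\<And>y. y \<in> V \<Longrightarrow> (g has_derivative (g' y)) (at y)"
    and inv: "\<And>y. y \<in> V \<Longrightarrow> g' y = inv (blinfun_apply (F (g y)))"
    and bij: "\<And>y. y \<in> V \<Longrightarrow> bij (blinfun_apply (F (g y)))"
    using inverse_function_theorem[OF open_UNIV derF contF UNIV_I GF] by metis
  obtain r where r: "0 < r" "ball (f x0) r \<subseteq> V" using V open_contains_ball by blast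
  define e where "e = r / (norm v + 1)"
  have n1: "0 < norm v + 1" by (simp add: add_nonneg_pos)
  have e: "0 < e" using r n1 by (simp add: e_def)
  define l where "l t = f x0 + t *\<^sub>R v" for t
  have l: "l t \<in> V" if "\<bar>t\<bar> < e" for t
  proof -
    have "norm (t *\<^sub>R v) \<le> \<bar>t\<bar> * (norm v + 1)" by (simp add: algebra_simps)
    also have "\<dots> < r" using that n1 by (simp add: e_def field_simps)
    finally have "l t \<in> ball (f x0) r" by (simp add: l_def dist_norm)
    then show ?thesis using r by blast
  qed
  define \<gamma> where "\<gamma> t = g (l t)" for t
  define \<gamma>' where "\<gamma>' t = g' (l t) v" for t
  have g0: "\<gamma> 0 = x0" using hom U by (simp add: \<gamma>_def l_def homeomorphism_apply1)
  have f\<gamma>: "f (\<gamma> t) = f x0 + t *\<^sub>R v" if "\<bar>t\<bar> < e" for t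
    using homeomorphism_apply2[OF hom l[OF that]] by (simp add: \<gamma>_def l_def)
  have der: "(\<gamma> has_vector_derivative \<gamma>' t) (at t)" if "\<bar>t\<bar> < e" for t
  proof -
    have "(l has_derivative (\<lambda>h. h *\<^sub>R v)) (at t)" unfolding l_def by (auto intro!: derivative_eq_intros)
    from has_derivative_compose[OF this g'[OF l[OF that]]]
    have "(\<gamma> has_derivative (\<lambda>h. g' (l t) (h *\<^sub>R v))) (at t)"
      unfolding \<gamma>_def .
    then show ?thesis
      using has_derivative_linear[OF g'[OF l[OF that]]]
      by (simp add: has_vector_derivative_def \<gamma>'_def linear_scale)
  qed
  have D\<gamma>: "D (\<gamma> t) (\<gamma>' t) = v" if "\<bar>t\<bar> < e" for t
    using inv[OF l[OF that]] bij[OF l[OF that]]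
    by (simp add: \<gamma>_def \<gamma>'_def F bij_is_surj surj_f_inv_f)
  \<comment> \<open>Applying the fixed inverse \<open>L\<close> to \<open>D (\<gamma> t) (\<gamma>' t) = v = D x0 (\<gamma>' 0)\<close>
    bounds \<open>\<gamma>' t - \<gamma>' 0\<close> by a vanishing multiple of \<open>\<gamma>' t\<close>.\<close>
  define d where "d t = norm G * norm (F x0 - F (\<gamma> t))" for t
  have step: "norm (\<gamma>' t - \<gamma>' 0) \<le> d t * norm (\<gamma>' t)" if "\<bar>t\<bar> < e" for t
  proof -
    have "\<gamma>' t - \<gamma>' 0 = L (D x0 (\<gamma>' t) - D x0 (\<gamma>' 0))"
      by (simp add: LD linear_diff[OF L(1)])
    also have "D x0 (\<gamma>' 0) = D (\<gamma> t) (\<gamma>' t)" using D\<gamma>[of 0] D\<gamma>[OF that] e g0 by simp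
    also have "L (D x0 (\<gamma>' t) - D (\<gamma> t) (\<gamma>' t)) = G ((F x0 - F (\<gamma> t)) (\<gamma>' t))"
      by (simp add: G F blinfun.diff_left)
    finally have "norm (\<gamma>' t - \<gamma>' 0) \<le> norm G * norm ((F x0 - F (\<gamma> t)) (\<gamma>' t))"
      by (metis norm_blinfun)
    also have "\<dots> \<le> norm G * (norm (F x0 - F (\<gamma> t)) * norm (\<gamma>' t))"
      by (intro mult_left_mono norm_blinfun) auto
    finally show ?thesis by (simp add: d_def mult.assoc)
  qed
  have d0: "(d \<longlongrightarrow> 0) (at 0)"
  proof -
    have "isCont \<gamma> 0" using der[of 0] e has_vector_derivative_continuous by auto
    moreover have "isCont F x" for x using contF by (simp add: continuous_on_eq_continuous_at)
    ultimately have "isCont (\<lambda>t. F (\<gamma> t)) 0" by (rule isCont_o2)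
    then have "((\<lambda>t. F (\<gamma> t)) \<longlongrightarrow> F x0) (at 0)" by (simp add: isCont_def g0)
    then have "(d \<longlongrightarrow> norm G * norm (F x0 - F x0)) (at 0)" unfolding d_def by (intro tendsto_intros)
    then show ?thesis by simp
  qed
  have near: "\<forall>\<^sub>F t in at 0. \<bar>t\<bar> < e"
    using e by (auto simp: eventually_at dist_real_def intro!: exI[of _ e])
  have "\<forall>\<^sub>F t in at 0. d t < 1/2" using order_tendstoD(2)[OF d0, of "1/2"] by simp
  then have "\<forall>\<^sub>F t in at 0. norm (\<gamma>' t - \<gamma>' 0) \<le> d t * (2 * norm (\<gamma>' 0))"
    using near
  proof eventually_elim
    case (elim t)
    have "0 \<le> d t" by (simp add: d_def)
    have "norm (\<gamma>' t) \<le> norm (\<gamma>' 0) + d t * norm (\<gamma>' t)"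
      using step[OF elim(2)] norm_triangle_sub[of "\<gamma>' t" "\<gamma>' 0"] by linarith
    also have "d t * norm (\<gamma>' t) \<le> 1/2 * norm (\<gamma>' t)" using elim by (intro mult_right_mono) auto
    finally have "norm (\<gamma>' t) \<le> 2 * norm (\<gamma>' 0)" by simp
    then have "d t * norm (\<gamma>' t) \<le> d t * (2 * norm (\<gamma>' 0))"
      using \<open>0 \<le> d t\<close> by (intro mult_left_mono)
    then show ?case using step[OF elim(2)] by linarith
  qed
  moreover have "((\<lambda>t. d t * (2 * norm (\<gamma>' 0))) \<longlongrightarrow> 0) (at 0)"
    using tendsto_mult_right[OF d0, of "2 * norm (\<gamma>' 0)"] by simp
  ultimately have "((\<lambda>t. \<gamma>' t - \<gamma>' 0) \<longlongrightarrow> 0) (at 0)" by (rule Lim_null_comparison)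
  then have "(\<gamma>' \<longlongrightarrow> \<gamma>' 0) (at 0)" by (rule LIM_zero_cancel)
  then show ?thesis using that[OF e g0 f\<gamma> der] by blast
qed

context fully_indecomposable_profile
begin

text \<open>
  In the coordinates \<open>\<xi> = x / p\<close> and \<open>\<eta> = x' / p'\<close> the hypotheses read \<open>\<xi> = - S \<eta>\<close> and \<open>\<eta> = - S\<^sup>T \<xi>\<close>, with \<open>S\<close> the scaled matrix,
  so that \<open>\<xi>\<close> and \<open>- \<eta>\<close> are averages of each other. By the maximum principle
  both equal a constant \<open>M\<close>. This is the tangent direction of the scaling \<open>(\<lambda> p, p' / \<lambda>)\<close>, and
  the balance of the totals excludes it.
\<close>

lemma linearised_scaling_kernel:
  assumes p: "\<And>i. 0 < p $ i" "\<And>i. 0 < p' $ i"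
    and rows: "\<And>i. p $ i * (V *v p') $ i = 1" and cols: "\<And>i. p' $ i * (transpose V *v p) $ i = 1"
    and k: "\<And>i. (V *v p') $ i * x $ i = - p $ i * (V *v x') $ i"
    and k': "\<And>i. (transpose V *v p) $ i * x' $ i = - p' $ i * (transpose V *v x) $ i"
    and bal: "(\<Sum>i\<in>UNIV. x $ i) = (\<Sum>i\<in>UNIV. x' $ i)"
  shows "x = 0 \<and> x' = 0"
proof -
  define a where "a = V *v p'"
  define b where "b = transpose V *v p"
  have pos: "0 < a $ i" "0 < b $ i" for i
    using p by (auto simp: a_def b_def intro: mult_vec_pos transpose_mult_vec_pos)
  define R where "R = range (\<lambda>i. x $ i / p $ i) \<union> range (\<lambda>i. - x' $ i / p' $ i)"
  define M where "M = Max R"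
  have MR: "M \<in> R" unfolding M_def by (rule Max_in) (auto simp: R_def)
  have M_ge: "y \<le> M" if "y \<in> R" for y using that unfolding M_def by (intro Max_ge) (auto simp: R_def)
  have xM: "0 \<le> M * p $ i - x $ i" for i
    using M_ge[of "x $ i / p $ i"] p(1)[of i] by (auto simp: R_def field_simps)
  have x'M: "0 \<le> x' $ i + M * p' $ i" for i
  proof -
    have "- x' $ i / p' $ i \<le> M" by (rule M_ge) (simp add: R_def)
    then show ?thesis using p(2)[of i] by (simp add: field_simps)
  qed
  define E where "E = {i. x $ i = M * p $ i}"
  define F where "F = {i. x' $ i = - M * p' $ i}"
  have ne: "E \<noteq> {} \<or> F \<noteq> {}"
  proof -
    from MR consider i where "M = x $ i / p $ i" | i where "M = - x' $ i / p' $ i"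
      unfolding R_def by blast
    then show ?thesis
    proof cases
      case (1 i)
      then have "i \<in> E" using p(1)[of i] by (simp add: E_def)
      then show ?thesis by blast
    next
      case (2 i)
      then have "i \<in> F" using p(2)[of i] by (simp add: F_def)
      then show ?thesis by blast
    qed
  qed
  have closed: "i \<in> E \<longleftrightarrow> j \<in> F" if ij: "0 < V $ i $ j" for i j
  proof
    assume "i \<in> E"
    have "p $ i * ((V *v x') $ i + M * a $ i) = 0"
      using k[of i] \<open>i \<in> E\<close> by (simp add: E_def algebra_simps flip: a_def)
    then have "(V *v x') $ i + M * a $ i = 0" using p(1)[of i] by simp
    then have "(\<Sum>j\<in>UNIV. V $ i $ j * (x' $ j + M * p' $ j)) = 0"
      by (simp add: a_def matrix_vector_nth sum_distrib_left algebra_simps sum.distrib)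
    then have "V $ i $ j * (x' $ j + M * p' $ j) = 0"
      by (rule sum_nonneg_eq_0_D[rotated]) (intro mult_nonneg_nonneg nonneg x'M)
    then show "j \<in> F" using ij by (simp add: F_def)
  next
    assume "j \<in> F"
    have "p' $ j * (M * b $ j - (transpose V *v x) $ j) = 0"
      using k'[of j] \<open>j \<in> F\<close> by (simp add: F_def algebra_simps flip: b_def)
    then have "M * b $ j - (transpose V *v x) $ j = 0" using p(2)[of j] by simp
    then have "(\<Sum>i\<in>UNIV. V $ i $ j * (M * p $ i - x $ i)) = 0"
      by (simp add: b_def transpose_vector_nth sum_distrib_left algebra_simps sum_subtractf)
    then have "V $ i $ j * (M * p $ i - x $ i) = 0"
      by (rule sum_nonneg_eq_0_D[rotated]) (intro mult_nonneg_nonneg nonneg xM)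
    then show "i \<in> E" using ij by (simp add: E_def)
  qed
  have "E = UNIV" "F = UNIV" using bipartite_connected[OF ne closed] by blast+
  then have x: "x $ i = M * p $ i" "x' $ i = - M * p' $ i" for i by (auto simp: E_def F_def)
  have "M * (\<Sum>i\<in>UNIV. p $ i) = - M * (\<Sum>i\<in>UNIV. p' $ i)"
    using bal unfolding x by (simp add: sum_distrib_left sum_negf)
  then have "M * ((\<Sum>i\<in>UNIV. p $ i) + (\<Sum>i\<in>UNIV. p' $ i)) = 0" by (simp add: distrib_left)
  moreover have "0 < (\<Sum>i\<in>UNIV. p $ i) + (\<Sum>i\<in>UNIV. p' $ i)"
    using p by (intro add_pos_pos sum_pos) auto
  ultimately have "M = 0" by simp
  then show ?thesis using x by (simp add: vec_eq_iff)
qed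

text \<open>
  The implicit function theorem at \<open>t = s\<^sup>2 = 0\<close>. The \<open>2 n\<close> master equations, multiplied by their
  denominators, satisfy one identity, because \<open>\<langle>q, V q'\<rangle> = \<langle>V\<^sup>T q, q'\<rangle>\<close>; together with the balance
  equation there are \<open>2 n + 1\<close> equations for \<open>2 n\<close> unknowns. Adding the sum defect \<open>\<delta>\<close> to the first
  family and subtracting it from the second one gives a square polynomial system \<open>f\<close>, and the same
  identity shows that its zeros have \<open>\<delta> = 0\<close>, both for the linearisation and for the system itself.
\<close>

lemma perturbed_master_solutions:
  assumes p: "\<And>i. 0 < p $ i" "\<And>i. 0 < p' $ i"
    and rows: "\<And>i. p $ i * (V *v p') $ i = 1" and cols: "\<And>i. p' $ i * (transpose V *v p) $ i = 1"
    and bal: "(\<Sum>i\<in>UNIV. p $ i) = (\<Sum>i\<in>UNIV. p' $ i)"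
  obtains e q q' dq dq' where "0 < e" "q 0 = p" "q' 0 = p'"
    "\<And>t. \<bar>t\<bar> < e \<Longrightarrow> (q has_vector_derivative dq t) (at t)"
    "\<And>t. \<bar>t\<bar> < e \<Longrightarrow> (q' has_vector_derivative dq' t) (at t)"
    "(dq \<longlongrightarrow> dq 0) (at 0)" "(dq' \<longlongrightarrow> dq' 0) (at 0)"
    "\<And>t. 0 < t \<Longrightarrow> t < e \<Longrightarrow> master_equations V (sqrt t) (q t) (q' t) \<and> (\<forall>i. 0 < q t $ i)"
proof -
  define Q :: "'n \<Rightarrow> real \<times> (real^'n) \<times> (real^'n) \<Rightarrow> real" where "Q i x = fst (snd x) $ i" for i x
  define Q' :: "'n \<Rightarrow> real \<times> (real^'n) \<times> (real^'n) \<Rightarrow> real" where "Q' i x = snd (snd x) $ i" for i x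
  define A :: "'n \<Rightarrow> real \<times> (real^'n) \<times> (real^'n) \<Rightarrow> real" where "A i x = (V *v snd (snd x)) $ i" for i x
  define B :: "'n \<Rightarrow> real \<times> (real^'n) \<times> (real^'n) \<Rightarrow> real"
    where "B i x = (transpose V *v fst (snd x)) $ i" for i x
  define \<delta> :: "real \<times> (real^'n) \<times> (real^'n) \<Rightarrow> real"
    where "\<delta> x = (\<Sum>i\<in>UNIV. fst (snd x) $ i) - (\<Sum>i\<in>UNIV. snd (snd x) $ i)" for x
  have lin: "bounded_linear (Q i)" "bounded_linear (Q' i)" "bounded_linear (A i)" "bounded_linear (B i)"
    "bounded_linear \<delta>" for i
    unfolding linear_conv_bounded_linear[symmetric] Q_def Q'_def A_def B_def \<delta>_def
    by (rule linearI; simp add: matrix_vector_right_distrib matrix_vector_mult_scaleR sum.distrib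
        sum_distrib_left[symmetric] algebra_simps)+
  note der [derivative_intros] = lin[THEN bounded_linear_imp_has_derivative]
  have cont [continuous_intros]: "continuous_on S (Q i)" "continuous_on S (Q' i)" "continuous_on S (A i)"
    "continuous_on S (B i)" "continuous_on S \<delta>" for i S
    using lin by (auto intro: linear_continuous_on)
  define f where "f x = (fst x,
      (\<chi> i. Q i x * (fst x + A i x * B i x) - B i x + \<delta> x) :: real^'n,
      (\<chi> i. Q' i x * (fst x + A i x * B i x) - A i x - \<delta> x) :: real^'n)" for x
  define D where "D x h = (fst h,
      (\<chi> i. Q i h * (fst x + A i x * B i x)
          + Q i x * (fst h + (A i h * B i x + A i x * B i h)) - B i h + \<delta> h) :: real^'n,
      (\<chi> i. Q' i h * (fst x + A i x * B i x)
          + Q' i x * (fst h + (A i h * B i x + A i x * B i h)) - A i h - \<delta> h) :: real^'n)" for x h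
  define x0 where "x0 = (0::real, p, p')"
  define a where "a = V *v p'"
  define b where "b = transpose V *v p"
  have pos: "0 < a $ i" "0 < b $ i" for i
    using p by (auto simp: a_def b_def intro: mult_vec_pos transpose_mult_vec_pos)
  have pa: "p $ i * a $ i = 1" and p'b: "p' $ i * b $ i = 1" for i
    using rows cols by (auto simp: a_def b_def)
  have at0: "Q i x0 = p $ i" "Q' i x0 = p' $ i" "A i x0 = a $ i" "B i x0 = b $ i" "fst x0 = 0" "\<delta> x0 = 0" for i
    using bal by (auto simp: Q_def Q'_def A_def B_def \<delta>_def x0_def a_def b_def)
  have fx0: "f x0 = 0"
    using pa p'b by (simp add: f_def at0 vec_eq_iff zero_prod_def ac_simps)
  have derf: "(f has_derivative D x) (at x)" for x
    unfolding f_def D_def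
    by (intro has_derivative_Pair has_derivative_vec_lambda) (auto intro!: derivative_eq_intros der)
  have contD: "continuous_on UNIV (\<lambda>x. D x h)" for h
    unfolding D_def by (intro continuous_intros)
  have inj: "h = 0" if "D x0 h = 0" for h
  proof -
    obtain t x x' where h: "h = (t, x, x')" by (cases h)
    have t: "t = 0" using that by (simp add: D_def h zero_prod_def)
    define \<alpha> where "\<alpha> = V *v x'"
    define \<beta> where "\<beta> = transpose V *v x"
    have ath: "Q i h = x $ i" "Q' i h = x' $ i" "A i h = \<alpha> $ i" "B i h = \<beta> $ i" "fst h = 0" for i
      by (auto simp: Q_def Q'_def A_def B_def h \<alpha>_def \<beta>_def t)
    have E1': "x $ i * (a $ i * b $ i) + p $ i * (\<alpha> $ i * b $ i + a $ i * \<beta> $ i) - \<beta> $ i + \<delta> h = 0" for i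
      using that by (simp add: D_def at0 ath zero_prod_def vec_eq_iff)
    have E1: "a $ i * x $ i + p $ i * \<alpha> $ i = - \<delta> h * (1 / b $ i)" for i
    proof -
      have "b $ i * (a $ i * x $ i + p $ i * \<alpha> $ i) = - \<delta> h" using E1'[of i] pa[of i] by algebra
      then show ?thesis using pos[of i] by (simp add: field_simps)
    qed
    have E2': "x' $ i * (a $ i * b $ i) + p' $ i * (\<alpha> $ i * b $ i + a $ i * \<beta> $ i) - \<alpha> $ i - \<delta> h = 0" for i
      using that by (simp add: D_def at0 ath zero_prod_def vec_eq_iff)
    have E2: "b $ i * x' $ i + p' $ i * \<beta> $ i = \<delta> h * (1 / a $ i)" for i
    proof -
      have "a $ i * (b $ i * x' $ i + p' $ i * \<beta> $ i) = \<delta> h" using E2'[of i] p'b[of i] by algebra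
      then show ?thesis using pos[of i] by (simp add: field_simps)
    qed
    \<comment> \<open>The two families of equations have the same total, which forces the sum defect to vanish.\<close>
    have "(\<Sum>i\<in>UNIV. a $ i * x $ i + p $ i * \<alpha> $ i) = (\<Sum>i\<in>UNIV. b $ i * x' $ i + p' $ i * \<beta> $ i)"
      unfolding sum.distrib
      using inner_mult_vec_transpose[of x V p'] inner_mult_vec_transpose[of p V x']
      by (simp add: a_def b_def \<alpha>_def \<beta>_def mult.commute)
    then have "- \<delta> h * (\<Sum>i\<in>UNIV. 1 / b $ i) = \<delta> h * (\<Sum>i\<in>UNIV. 1 / a $ i)"
      unfolding E1 E2 sum_distrib_left .
    then have "\<delta> h * ((\<Sum>i\<in>UNIV. 1 / b $ i) + (\<Sum>i\<in>UNIV. 1 / a $ i)) = 0"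
      by (simp add: distrib_left)
    moreover have "0 < (\<Sum>i\<in>UNIV. 1 / b $ i) + (\<Sum>i\<in>UNIV. 1 / a $ i)"
      using pos by (intro add_pos_pos sum_pos) auto
    ultimately have \<delta>: "\<delta> h = 0" by simp
    have "x = 0 \<and> x' = 0"
    proof (rule linearised_scaling_kernel[OF p rows cols])
      show "(V *v p') $ i * x $ i = - p $ i * (V *v x') $ i" for i
        using E1[of i] \<delta> by (simp add: a_def \<alpha>_def)
      show "(transpose V *v p) $ i * x' $ i = - p' $ i * (transpose V *v x) $ i" for i
        using E2[of i] \<delta> by (simp add: b_def \<beta>_def)
      show "(\<Sum>i\<in>UNIV. x $ i) = (\<Sum>i\<in>UNIV. x' $ i)" using \<delta> by (simp add: \<delta>_def h)
    qed
    then show ?thesis by (simp add: h t zero_prod_def)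
  qed
  obtain e \<gamma> \<gamma>' where e: "0 < e" and \<gamma>0: "\<gamma> 0 = x0"
    and f\<gamma>: "\<And>t. \<bar>t\<bar> < e \<Longrightarrow> f (\<gamma> t) = f x0 + t *\<^sub>R (1, 0, 0)"
    and d\<gamma>: "\<And>t. \<bar>t\<bar> < e \<Longrightarrow> (\<gamma> has_vector_derivative \<gamma>' t) (at t)"
    and lim: "(\<gamma>' \<longlongrightarrow> \<gamma>' 0) (at 0)"
    using smooth_preimage_of_line[where f=f and D=D and ?x0.0=x0 and v="(1,0,0)", OF derf contD inj] by metis
  have cont\<gamma>: "isCont \<gamma> 0" using d\<gamma>[of 0] e has_vector_derivative_continuous by auto
  have "\<forall>\<^sub>F t in at 0. \<forall>i. 0 < Q i (\<gamma> t) \<and> 0 < Q' i (\<gamma> t)"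
  proof (intro eventually_all_finite eventually_conj)
    fix i
    have "isCont (\<lambda>t. Q i (\<gamma> t)) 0" "isCont (\<lambda>t. Q' i (\<gamma> t)) 0"
      using lin cont\<gamma> by (auto intro: bounded_linear.continuous)
    then have "((\<lambda>t. Q i (\<gamma> t)) \<longlongrightarrow> p $ i) (at 0)" "((\<lambda>t. Q' i (\<gamma> t)) \<longlongrightarrow> p' $ i) (at 0)"
      by (simp_all add: isCont_def \<gamma>0 at0)
    then show "\<forall>\<^sub>F t in at 0. 0 < Q i (\<gamma> t)" "\<forall>\<^sub>F t in at 0. 0 < Q' i (\<gamma> t)"
      using p order_tendstoD(1) by blast+
  qed
  then obtain r where r: "0 < r" and near: "\<And>t. t \<noteq> 0 \<Longrightarrow> \<bar>t\<bar> < r \<Longrightarrow> \<forall>i. 0 < Q i (\<gamma> t) \<and> 0 < Q' i (\<gamma> t)"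
    unfolding eventually_at by (auto simp: dist_real_def)
  define q where "q t = fst (snd (\<gamma> t))" for t
  define q' where "q' t = snd (snd (\<gamma> t))" for t
  define dq where "dq t = fst (snd (\<gamma>' t))" for t
  define dq' where "dq' t = snd (snd (\<gamma>' t))" for t
  have bl: "bounded_linear (\<lambda>x::real \<times> (real^'n) \<times> (real^'n). fst (snd x))"
    "bounded_linear (\<lambda>x::real \<times> (real^'n) \<times> (real^'n). snd (snd x))"
    by (intro bounded_linear_compose[OF bounded_linear_fst] bounded_linear_compose[OF bounded_linear_snd]
        bounded_linear_snd)+
  show ?thesis
  proof (rule that[of "min e r" q q' dq dq'])
    show "0 < min e r" using e r by simp
    show "q 0 = p" "q' 0 = p'" by (simp_all add: q_def q'_def \<gamma>0 x0_def)
    show "(q has_vector_derivative dq t) (at t)" "(q' has_vector_derivative dq' t) (at t)"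
      if "\<bar>t\<bar> < min e r" for t
      unfolding q_def q'_def dq_def dq'_def
      using that by (auto intro!: bounded_linear.has_vector_derivative[OF bl(1)]
          bounded_linear.has_vector_derivative[OF bl(2)] d\<gamma>)
    show "(dq \<longlongrightarrow> dq 0) (at 0)" "(dq' \<longlongrightarrow> dq' 0) (at 0)"
      unfolding dq_def dq'_def by (intro tendsto_intros lim)+
    fix t :: real assume t: "0 < t" "t < min e r"
    define \<alpha> where "\<alpha> = V *v q' t"
    define \<beta> where "\<beta> = transpose V *v q t"
    have qpos: "0 < q t $ i" "0 < q' t $ i" for i
      using near[of t] t by (auto simp: Q_def Q'_def q_def q'_def)
    have \<alpha>\<beta>: "0 < \<alpha> $ i" "0 < \<beta> $ i" for i
      using qpos by (auto simp: \<alpha>_def \<beta>_def intro: mult_vec_pos transpose_mult_vec_pos)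
    have den: "0 < t + \<alpha> $ i * \<beta> $ i" for i using t \<alpha>\<beta>[of i] by (simp add: add_pos_pos)
    have ft: "f (\<gamma> t) = (t, 0, 0)" using f\<gamma>[of t] t by (simp add: fx0)
    then have fst\<gamma>: "fst (\<gamma> t) = t" by (simp add: f_def)
    define d where "d = \<delta> (\<gamma> t)"
    have at\<gamma>: "Q i (\<gamma> t) = q t $ i" "Q' i (\<gamma> t) = q' t $ i" "A i (\<gamma> t) = \<alpha> $ i" "B i (\<gamma> t) = \<beta> $ i" for i
      by (auto simp: Q_def Q'_def A_def B_def q_def q'_def \<alpha>_def \<beta>_def)
    have "q t $ i * (t + \<alpha> $ i * \<beta> $ i) - \<beta> $ i + d = 0" for i
      using ft by (simp add: f_def at\<gamma> fst\<gamma> d_def vec_eq_iff)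
    then have q: "q t $ i = (\<beta> $ i - d) / (t + \<alpha> $ i * \<beta> $ i)" for i
      using den[of i] by (simp add: field_simps)
    have "q' t $ i * (t + \<alpha> $ i * \<beta> $ i) - \<alpha> $ i - d = 0" for i
      using ft by (simp add: f_def at\<gamma> fst\<gamma> d_def vec_eq_iff)
    then have q': "q' t $ i = (\<alpha> $ i + d) / (t + \<alpha> $ i * \<beta> $ i)" for i
      using den[of i] by (simp add: field_simps)
    \<comment> \<open>The identity between the two families, now for the full system.\<close>
    have "(\<Sum>i\<in>UNIV. q t $ i * \<alpha> $ i) = (\<Sum>i\<in>UNIV. q' t $ i * \<beta> $ i)"
      using inner_mult_vec_transpose[of "q t" V "q' t"] by (simp add: \<alpha>_def \<beta>_def)
    then have "(\<Sum>i\<in>UNIV. q' t $ i * \<beta> $ i - q t $ i * \<alpha> $ i) = 0" by (simp add: sum_subtractf)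
    moreover have "q' t $ i * \<beta> $ i - q t $ i * \<alpha> $ i = d * ((\<alpha> $ i + \<beta> $ i) / (t + \<alpha> $ i * \<beta> $ i))" for i
      unfolding q q' by (simp add: diff_divide_distrib[symmetric] algebra_simps)
    ultimately have "d * (\<Sum>i\<in>UNIV. (\<alpha> $ i + \<beta> $ i) / (t + \<alpha> $ i * \<beta> $ i)) = 0"
      by (simp add: sum_distrib_left)
    moreover have "0 < (\<Sum>i\<in>UNIV. (\<alpha> $ i + \<beta> $ i) / (t + \<alpha> $ i * \<beta> $ i))"
      by (intro sum_pos divide_pos_pos den) (simp_all add: add_pos_pos \<alpha>\<beta>)
    ultimately have d0: "d = 0" by simp
    then have "(\<Sum>i\<in>UNIV. q t $ i) = (\<Sum>i\<in>UNIV. q' t $ i)"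
      by (simp add: d_def \<delta>_def q_def q'_def)
    moreover have "(sqrt t)\<^sup>2 = t" using t by simp
    moreover have "q t $ i = \<beta> $ i / (t + \<alpha> $ i * \<beta> $ i)" "q' t $ i = \<alpha> $ i / (t + \<alpha> $ i * \<beta> $ i)" for i
      using q[of i] q'[of i] d0 by simp_all
    moreover have "0 \<le> q t $ i" "0 \<le> q' t $ i" for i
      using qpos[of i] by simp_all
    ultimately show "master_equations V (sqrt t) (q t) (q' t) \<and> (\<forall>i. 0 < q t $ i)"
      unfolding master_equations_def \<alpha>_def[symmetric] \<beta>_def[symmetric] using qpos(1) by metis
  qed
qed

lemma master_cdf_eq:
  assumes "0 < s" and M: "master_equations V s q q'" and sol: "master_solution V s = (q, q')"
  shows "master_cdf V s =
    (\<Sum>i\<in>UNIV. s\<^sup>2 / (s\<^sup>2 + (V *v q') $ i * (transpose V *v q) $ i)) / real CARD('n)"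
proof -
  define a where "a = V *v q'"
  define b where "b = transpose V *v q"
  have q: "q $ i = b $ i / (s\<^sup>2 + a $ i * b $ i)" and q0: "0 \<le> q $ i" "0 \<le> q' $ i" for i
    using M by (auto simp: master_equations_def a_def b_def)
  have ab: "0 \<le> a $ i * b $ i" for i
    unfolding a_def b_def by (intro mult_nonneg_nonneg mult_vec_nonneg transpose_mult_vec_nonneg q0)
  have den: "0 < s\<^sup>2 + a $ i * b $ i" for i using assms(1) ab[of i] by (simp add: add_pos_nonneg)
  have "q \<bullet> a = (\<Sum>i\<in>UNIV. q $ i * a $ i)" by (simp add: inner_vec_def)
  also have "\<dots> = (\<Sum>i\<in>UNIV. 1 - s\<^sup>2 / (s\<^sup>2 + a $ i * b $ i))"
    using den by (intro sum.cong refl) (simp add: q field_simps less_imp_neq[OF den, symmetric])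
  also have "\<dots> = real CARD('n) - (\<Sum>i\<in>UNIV. s\<^sup>2 / (s\<^sup>2 + a $ i * b $ i))"
    by (simp add: sum_subtractf)
  finally show ?thesis
    unfolding master_cdf_def sol a_def[symmetric] b_def[symmetric]
    by (simp add: field_simps flip: a_def)
qed

lemma spec_radius_pos: "0 < spec_radius V"
proof -
  obtain x l where x: "\<And>i. 0 < x $ i" and l: "0 < l" and eig: "V *v x = l *\<^sub>R x"
    using perron_vector by metis
  then show ?thesis using spec_radius_eq_perron[OF nonneg x eig] by simp
qed

text \<open>
  With \<open>G t\<close> the average of \<open>t / (t + a\<^sub>i b\<^sub>i)\<close> along the solution curve, the distribution function is
  \<open>G (s\<^sup>2)\<close>, so the factor \<open>2 s\<close> of the chain rule cancels against the \<open>2 \<pi> s\<close> in the density, and the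
  density at radius \<open>s\<close> is \<open>G' (s\<^sup>2) / \<pi>\<close>. As \<open>t\<close> tends to zero, the terms of \<open>G'\<close> that involve the velocity
  of the curve carry a factor \<open>t\<close> and disappear, and \<open>1 / (a\<^sub>i b\<^sub>i)\<close> tends to \<open>p\<^sub>i p'\<^sub>i\<close>.
\<close>

lemma punctured_density_tendsto:
  assumes p: "\<And>i. 0 < p $ i" "\<And>i. 0 < p' $ i"
    and rows: "\<And>i. p $ i * (V *v p') $ i = 1" and cols: "\<And>i. p' $ i * (transpose V *v p) $ i = 1"
    and bal: "(\<Sum>i\<in>UNIV. p $ i) = (\<Sum>i\<in>UNIV. p' $ i)"
  shows "(punctured_density V \<longlongrightarrow> (\<Sum>i\<in>UNIV. p $ i * p' $ i) / (pi * real CARD('n))) (at 0)"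
proof -
  obtain e q q' dq dq' where e: "0 < e" and q0: "q 0 = p" "q' 0 = p'"
    and dq: "\<And>t. \<bar>t\<bar> < e \<Longrightarrow> (q has_vector_derivative dq t) (at t)"
      "\<And>t. \<bar>t\<bar> < e \<Longrightarrow> (q' has_vector_derivative dq' t) (at t)"
    and lim: "(dq \<longlongrightarrow> dq 0) (at 0)" "(dq' \<longlongrightarrow> dq' 0) (at 0)"
    and sol: "\<And>t. 0 < t \<Longrightarrow> t < e \<Longrightarrow> master_equations V (sqrt t) (q t) (q' t) \<and> (\<forall>i. 0 < q t $ i)"
    using perturbed_master_solutions[OF p rows cols bal] by blast
  define a where "a i t = (V *v q' t) $ i" for i t
  define b where "b i t = (transpose V *v q t) $ i" for i t
  define da where "da i t = (V *v dq' t) $ i" for i t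
  define db where "db i t = (transpose V *v dq t) $ i" for i t
  have bl: "bounded_linear (\<lambda>x. (A *v x) $ i)" for A :: "real^'n^'n" and i
    by (rule bounded_linear_compose[OF bounded_linear_vec_nth matrix_vector_mul_bounded_linear])
  have der: "(a i has_real_derivative da i t) (at t)" "(b i has_real_derivative db i t) (at t)"
    if "\<bar>t\<bar> < e" for i t
    unfolding has_real_derivative_iff_has_vector_derivative a_def b_def da_def db_def
    by (rule bounded_linear.has_vector_derivative[OF bl], rule dq, rule that)+
  have lim_d: "(da i \<longlongrightarrow> da i 0) (at 0)" "(db i \<longlongrightarrow> db i 0) (at 0)" for i
    unfolding da_def db_def by (rule bounded_linear.tendsto[OF bl], rule lim)+
  have lim_ab: "(a i \<longlongrightarrow> a i 0) (at 0)" "(b i \<longlongrightarrow> b i 0) (at 0)" for i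
    using der[of 0 i] e by (auto dest!: DERIV_isCont simp: isCont_def)
  have ab0: "a i 0 * b i 0 = 1 / (p $ i * p' $ i)" "0 < a i 0 * b i 0" for i
  proof -
    show *: "a i 0 * b i 0 = 1 / (p $ i * p' $ i)"
      using rows[of i] cols[of i] p(1)[of i] p(2)[of i]
      by (simp add: a_def b_def q0 field_simps)
    show "0 < a i 0 * b i 0" using p(1)[of i] p(2)[of i] by (simp add: *)
  qed
  define w where "w i t = t + a i t * b i t" for i t
  have "((\<lambda>t. w i t) \<longlongrightarrow> 0 + a i 0 * b i 0) (at 0)" for i
    unfolding w_def by (intro tendsto_intros lim_ab)
  then have lim_w: "(w i \<longlongrightarrow> a i 0 * b i 0) (at 0)" for i by simp
  define G where "G t = (\<Sum>i\<in>UNIV. t / w i t) / real CARD('n)" for t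
  define dG where "dG t = (\<Sum>i\<in>UNIV. (w i t - t * (1 + (da i t * b i t + a i t * db i t))) / (w i t)\<^sup>2)
      / real CARD('n)" for t
  have "(dG \<longlongrightarrow> (\<Sum>i\<in>UNIV. (a i 0 * b i 0 - 0 * (1 + (da i 0 * b i 0 + a i 0 * db i 0))) / (a i 0 * b i 0)\<^sup>2)
      / real CARD('n)) (at 0)"
    unfolding dG_def
  proof (intro tendsto_intros lim_w lim_ab lim_d)
    show "(a i 0 * b i 0)\<^sup>2 \<noteq> 0" for i using ab0(2)[of i] by (metis less_irrefl zero_eq_power2)
  qed simp
  moreover have "(a i 0 * b i 0 - 0 * (1 + (da i 0 * b i 0 + a i 0 * db i 0))) / (a i 0 * b i 0)\<^sup>2 = p $ i * p' $ i" for i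
    using p(1)[of i] p(2)[of i] by (simp add: ab0(1) power2_eq_square)
  ultimately have lim_dG: "(dG \<longlongrightarrow> (\<Sum>i\<in>UNIV. p $ i * p' $ i) / real CARD('n)) (at 0)" by simp
  have wpos: "0 < w i t" if t: "0 < t" "t < e" for i t
  proof -
    from sol[OF t] have "\<And>i. 0 \<le> q t $ i" "\<And>i. 0 \<le> q' t $ i" by (auto simp: master_equations_def)
    then show ?thesis unfolding w_def a_def b_def
      by (intro add_pos_nonneg t(1) mult_nonneg_nonneg mult_vec_nonneg transpose_mult_vec_nonneg)
  qed
  have derG: "(G has_real_derivative dG t) (at t)" if t: "0 < t" "t < e" for t
  proof -
    have "(w i has_real_derivative 1 + (da i t * b i t + a i t * db i t)) (at t)" for i
      unfolding w_def using t by (auto intro!: derivative_eq_intros der)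
    then have "((\<lambda>t. t / w i t) has_real_derivative
        (w i t - t * (1 + (da i t * b i t + a i t * db i t))) / (w i t)\<^sup>2) (at t)" for i
      using wpos[OF t, of i] by (auto intro!: derivative_eq_intros simp: power2_eq_square)
    then show ?thesis unfolding G_def dG_def by (intro DERIV_cdivide DERIV_sum)
  qed
  define r where "r = min (sqrt e) (sqrt (spec_radius V))"
  have r: "0 < r" using e spec_radius_pos by (simp add: r_def)
  have sq: "0 < s\<^sup>2" "s\<^sup>2 < e" if "0 < s" "s < r" for s
  proof -
    show "0 < s\<^sup>2" using that by simp
    have "s < sqrt e" using that by (simp add: r_def)
    then have "s\<^sup>2 < (sqrt e)\<^sup>2" using that by (intro power_strict_mono) auto
    then show "s\<^sup>2 < e" using e by simp
  qed
  have cdf: "master_cdf V s = G (s\<^sup>2)" if s: "0 < s" "s < r" for s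
  proof -
    have M: "master_equations V s (q (s\<^sup>2)) (q' (s\<^sup>2))" and pos: "0 < q (s\<^sup>2) $ i" for i
      using sol[OF sq[OF s]] s by auto
    have "(q (s\<^sup>2), q' (s\<^sup>2)) \<noteq> (0, 0)" using pos by (metis less_irrefl prod.inject zero_index)
    then have "master_solution V s = (q (s\<^sup>2), q' (s\<^sup>2))"
      using s by (intro master_solution_eqI M) (auto simp: r_def)
    from master_cdf_eq[OF s(1) M this] show ?thesis
      by (simp add: G_def w_def a_def b_def)
  qed
  have dens: "punctured_density V z = dG ((cmod z)\<^sup>2) / pi" if z: "z \<noteq> 0" "cmod z < r" for z
  proof -
    have s: "0 < cmod z" "cmod z < r" using z by auto
    have "((\<lambda>s. G (s\<^sup>2)) has_real_derivative dG ((cmod z)\<^sup>2) * (2 * cmod z)) (at (cmod z))"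
      by (rule DERIV_chain2[where f=G and g="\<lambda>s. s\<^sup>2", OF derG[OF sq[OF s]]]) (auto intro!: derivative_eq_intros)
    then have "(master_cdf V has_real_derivative dG ((cmod z)\<^sup>2) * (2 * cmod z)) (at (cmod z))"
      by (rule has_field_derivative_transform_within_open[where S="{0<..<r}"]) (use s cdf in auto)
    then have "deriv (master_cdf V) (cmod z) = dG ((cmod z)\<^sup>2) * (2 * cmod z)" by (rule DERIV_imp_deriv)
    then show ?thesis using s by (simp add: punctured_density_def r_def)
  qed
  have "((\<lambda>z::complex. (cmod z)\<^sup>2) \<longlongrightarrow> (cmod 0)\<^sup>2) (at 0)" by (intro tendsto_intros)
  then have "filterlim (\<lambda>z::complex. (cmod z)\<^sup>2) (at 0) (at 0)"
    by (intro filterlim_atI) (auto simp: eventually_at intro: exI[of _ 1])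
  from tendsto_divide[OF filterlim_compose[OF lim_dG this] tendsto_const[of pi]]
  have "((\<lambda>z. dG ((cmod z)\<^sup>2) / pi) \<longlongrightarrow> (\<Sum>i\<in>UNIV. p $ i * p' $ i) / (pi * real CARD('n))) (at 0)"
    by (simp add: mult.commute)
  moreover have "\<forall>\<^sub>F z in at 0. dG ((cmod z)\<^sup>2) / pi = punctured_density V z"
    unfolding eventually_at using r dens by (auto intro!: exI[of _ r])
  ultimately show ?thesis by (rule Lim_transform_eventually)
qed

end

section \<open>Radially symmetric measures\<close>

lemma nn_integral_lborel_translate:
  fixes h :: "'a::euclidean_space \<Rightarrow> ennreal"
  assumes [measurable]: "h \<in> borel_measurable borel"
  shows "(\<integral>\<^sup>+x. h (t + x) \<partial>lborel) = (\<integral>\<^sup>+x. h x \<partial>lborel)"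
proof -
  have "(\<integral>\<^sup>+x. h x \<partial>lborel) = (\<integral>\<^sup>+x. h x \<partial>distr lborel borel ((+) t))"
    using lborel_distr_plus[of t] by simp
  also have "\<dots> = (\<integral>\<^sup>+x. h (t + x) \<partial>lborel)" by (subst nn_integral_distr) auto
  finally show ?thesis by simp
qed

text \<open>
  The argument for uniqueness of Haar measure: for the unit ball \<open>B\<close>, Fubini's theorem and two
  translations give \<open>|A| |B| = |c\<^sup>-\<^sup>1 A| |B|\<close>, because \<open>B\<close> is mapped to itself by the rotation.
\<close>

lemma lborel_distr_rotation:
  fixes c :: complex
  assumes c: "cmod c = 1"
  shows "distr lborel borel (\<lambda>z. c * z) = lborel"
proof (rule measure_eqI)
  show "sets (distr lborel borel (\<lambda>z. c * z)) = sets lborel" by simp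
  fix A assume "A \<in> sets (distr lborel borel (\<lambda>z. c * z))"
  then have A [measurable]: "A \<in> sets borel" by simp
  have c0: "c \<noteq> 0" using c by auto
  define B :: "complex set" where "B = cball 0 1"
  have B [measurable]: "B \<in> sets borel" by (simp add: B_def)
  define \<beta> where "\<beta> = emeasure lborel B"
  have \<beta>: "\<beta> = ennreal pi" by (simp add: \<beta>_def B_def emeasure_cball eval_unit_ball_vol)
  have [measurable]: "(\<lambda>z. c * z) \<in> borel_measurable borel" by measurable
  have "emeasure lborel A * \<beta> = (\<integral>\<^sup>+x. (\<integral>\<^sup>+y. indicator A y \<partial>lborel) * indicator B x \<partial>lborel)"
    by (simp add: nn_integral_cmult \<beta>_def)
  also have "\<dots> = (\<integral>\<^sup>+x. (\<integral>\<^sup>+y. indicator A (c * x + y) * indicator B x \<partial>lborel) \<partial>lborel)"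
    by (intro nn_integral_cong) (simp add: nn_integral_multc nn_integral_lborel_translate[of "indicator A"])
  also have "\<dots> = (\<integral>\<^sup>+y. (\<integral>\<^sup>+x. indicator A (c * x + y) * indicator B x \<partial>lborel) \<partial>lborel)"
    by (rule lborel_pair.Fubini'[symmetric]) measurable
  also have "\<dots> = (\<integral>\<^sup>+y. (\<integral>\<^sup>+x. indicator A (c * x) * indicator B (- (y / c) + x) \<partial>lborel) \<partial>lborel)"
  proof (rule nn_integral_cong)
    fix y :: complex
    have *: "c * (- (y / c) + x) + y = c * x" for x using c0 by (simp add: distrib_left right_diff_distrib)
    have "(\<lambda>x. indicator A (c * x + y) * indicator B x :: ennreal) \<in> borel_measurable borel" by measurable
    from nn_integral_lborel_translate[OF this, of "- (y / c)"]
    show "(\<integral>\<^sup>+x. indicator A (c * x + y) * indicator B x \<partial>lborel) =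
        (\<integral>\<^sup>+x. indicator A (c * x) * indicator B (- (y / c) + x) \<partial>lborel)"
      unfolding * ..
  qed
  also have "\<dots> = (\<integral>\<^sup>+x. (\<integral>\<^sup>+y. indicator A (c * x) * indicator B (- (y / c) + x) \<partial>lborel) \<partial>lborel)"
    by (rule lborel_pair.Fubini') measurable
  also have "\<dots> = (\<integral>\<^sup>+x. indicator A (c * x) * \<beta> \<partial>lborel)"
  proof (rule nn_integral_cong)
    fix x :: complex
    have eq: "indicator B (- (y / c) + x) = (indicator (cball (c * x) 1) y :: ennreal)" for y
    proof -
      have "c * x - y = c * (- (y / c) + x)" using c0 by (simp add: field_simps)
      then have "cmod (c * x - y) = cmod (- (y / c) + x)" by (simp add: norm_mult c)
      then show ?thesis
        by (simp add: B_def indicator_def dist_norm norm_minus_commute[of "y / c" x])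
    qed
    have "(\<integral>\<^sup>+y. indicator A (c * x) * indicator (cball (c * x) 1) y \<partial>lborel) =
        indicator A (c * x) * emeasure lborel (cball (c * x) 1)"
      by (subst nn_integral_cmult) (auto intro!: borel_measurable_indicator)
    then show "(\<integral>\<^sup>+y. indicator A (c * x) * indicator B (- (y / c) + x) \<partial>lborel) = indicator A (c * x) * \<beta>"
      unfolding eq by (simp add: \<beta>_def B_def emeasure_cball)
  qed
  also have "\<dots> = (\<integral>\<^sup>+x. indicator A (c * x) \<partial>lborel) * \<beta>" by (subst nn_integral_multc) auto
  also have "(\<integral>\<^sup>+x. indicator A (c * x) \<partial>lborel) = emeasure (distr lborel borel (\<lambda>z. c * z)) A"
  proof -
    have "(\<integral>\<^sup>+x. indicator A (c * x) \<partial>lborel) = (\<integral>\<^sup>+x. indicator A x \<partial>distr lborel borel (\<lambda>z. c * z))"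
      by (subst nn_integral_distr) auto
    then show ?thesis by simp
  qed
  finally show "emeasure (distr lborel borel (\<lambda>z. c * z)) A = emeasure lborel A"
    by (auto simp: \<beta> ennreal_mult_cancel_left mult.commute[of _ "ennreal pi"])
qed

lemma disc_eq_cball: "{z. cmod z \<le> s} = cball 0 s"
  by auto

lemma emeasure_disc: "0 \<le> s \<Longrightarrow> emeasure lborel {z. cmod z \<le> s} = ennreal (pi * s\<^sup>2)"
  by (simp add: disc_eq_cball emeasure_cball eval_unit_ball_vol)

lemma uniform_disc:
  assumes R: "0 < R"
  defines "U \<equiv> uniform_measure lborel {z. cmod z \<le> R}"
  shows "prob_space U" and "sets U = sets borel" and "radially_symmetric U"
    and "0 \<le> s \<Longrightarrow> measure U {z. cmod z \<le> s} = (if s < R then s\<^sup>2 / R\<^sup>2 else 1)"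
proof -
  have D: "emeasure lborel {z. cmod z \<le> R} = ennreal (pi * R\<^sup>2)" using R by (simp add: emeasure_disc)
  have meas: "{z. cmod z \<le> s} \<in> sets lborel" for s by (simp add: disc_eq_cball)
  show "prob_space U" unfolding U_def by (rule prob_space_uniform_measure) (use R in \<open>simp_all add: D\<close>)
  show sets: "sets U = sets borel" by (simp add: U_def)
  show "radially_symmetric U" unfolding radially_symmetric_def
  proof (intro allI measure_eqI)
    fix \<theta> A
    show "sets (distr U borel (\<lambda>z. cis \<theta> * z)) = sets U" by (simp add: sets)
    assume "A \<in> sets (distr U borel (\<lambda>z. cis \<theta> * z))"
    then have A: "A \<in> sets borel" by simp
    have pre: "(\<lambda>z. cis \<theta> * z) -` B \<in> sets borel" if "B \<in> sets borel" for B
      using measurable_sets_borel[OF _ that, of "\<lambda>z. cis \<theta> * z"] by simp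
    have inv: "emeasure lborel ((\<lambda>z. cis \<theta> * z) -` B) = emeasure lborel B" if "B \<in> sets borel" for B
    proof -
      have "emeasure (distr lborel borel (\<lambda>z. cis \<theta> * z)) B = emeasure lborel ((\<lambda>z. cis \<theta> * z) -` B)"
        using that by (subst emeasure_distr) auto
      then show ?thesis by (simp add: lborel_distr_rotation)
    qed
    have "emeasure (distr U borel (\<lambda>z. cis \<theta> * z)) A = emeasure U ((\<lambda>z. cis \<theta> * z) -` A)"
      using A by (subst emeasure_distr) (auto simp: U_def)
    also have "\<dots> = emeasure lborel ({z. cmod z \<le> R} \<inter> (\<lambda>z. cis \<theta> * z) -` A) / ennreal (pi * R\<^sup>2)"
      unfolding U_def using pre[OF A] meas by (subst emeasure_uniform_measure) (auto simp: D)
    also have "{z. cmod z \<le> R} \<inter> (\<lambda>z. cis \<theta> * z) -` A = (\<lambda>z. cis \<theta> * z) -` ({z. cmod z \<le> R} \<inter> A)"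
      by (auto simp: norm_mult)
    also have "emeasure lborel \<dots> = emeasure lborel ({z. cmod z \<le> R} \<inter> A)"
      using A meas[of R] by (intro inv) auto
    also have "\<dots> / ennreal (pi * R\<^sup>2) = emeasure U A"
      unfolding U_def using A meas by (subst emeasure_uniform_measure) (auto simp: D)
    finally show "emeasure (distr U borel (\<lambda>z. cis \<theta> * z)) A = emeasure U A" .
  qed
  assume s: "0 \<le> s"
  have "measure U {z. cmod z \<le> s} = measure lborel ({z. cmod z \<le> R} \<inter> {z. cmod z \<le> s}) / measure lborel {z. cmod z \<le> R}"
    unfolding U_def by (rule measure_uniform_measure) (use R meas in \<open>simp_all add: D\<close>)
  also have "{z::complex. cmod z \<le> R} \<inter> {z. cmod z \<le> s} = {z. cmod z \<le> min R s}" by auto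
  also have "measure lborel {z. cmod z \<le> min R s} = pi * (min R s)\<^sup>2"
    unfolding measure_def using R s by (subst emeasure_disc) simp_all
  also have "measure lborel {z. cmod z \<le> R} = pi * R\<^sup>2" unfolding measure_def by (simp add: D)
  finally show "measure U {z. cmod z \<le> s} = (if s < R then s\<^sup>2 / R\<^sup>2 else 1)"
    using R by (auto simp: min_def)
qed

text \<open>
  Averaging the indicator of \<open>A\<close> over an independent direction \<open>sgn w\<close>, with \<open>w\<close> drawn from an auxiliary
  rotation invariant law \<open>U\<close>, does not change its \<open>M\<close>-integral; but after the averaging, by the invariance
  of \<open>U\<close>, the integrand depends only on the modulus. The condition \<open>U {0} = 0\<close> makes
  \<open>sgn w\<close> a unit vector almost surely.
\<close>

lemma radially_symmetric_emeasure:
  assumes M: "prob_space M" "sets M = sets borel" "radially_symmetric M"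
    and U: "prob_space U" "sets U = sets borel" "radially_symmetric U" "emeasure U {0} = 0"
    and A: "A \<in> sets borel"
  shows "emeasure M A = (\<integral>\<^sup>+r. (\<integral>\<^sup>+w. indicator A (complex_of_real r * sgn w) \<partial>U) \<partial>distr M borel cmod)"
proof -
  interpret M: prob_space M by fact
  interpret U: prob_space U by fact
  interpret P: pair_sigma_finite M U ..
  note [measurable_cong] = M(2) U(2)
  note A [measurable]
  have [measurable]: "(sgn :: complex \<Rightarrow> complex) \<in> borel_measurable borel"
    unfolding sgn_div_norm[abs_def] by measurable
  have [measurable]: "(\<lambda>z. cis \<theta> * z) \<in> borel_measurable borel" for \<theta> by measurable
  have rot: "(\<integral>\<^sup>+z. h (cis \<theta> * z) \<partial>N) = (\<integral>\<^sup>+z. h z \<partial>N)"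
    if N: "sets N = sets borel" "radially_symmetric N" and h [measurable]: "h \<in> borel_measurable borel"
    for N \<theta> and h :: "complex \<Rightarrow> ennreal"
  proof -
    note [measurable_cong] = N(1)
    have "(\<integral>\<^sup>+z. h z \<partial>N) = (\<integral>\<^sup>+z. h z \<partial>distr N borel (\<lambda>z. cis \<theta> * z))"
      using N(2) by (simp add: radially_symmetric_def)
    also have "\<dots> = (\<integral>\<^sup>+z. h (cis \<theta> * z) \<partial>N)" by (subst nn_integral_distr) auto
    finally show ?thesis by simp
  qed
  have "AE w in U. w \<noteq> 0" using U(4) by (subst AE_iff_measurable[of "{0}"]) (auto simp: U(2) sets_eq_imp_space_eq[OF U(2)])
  have "emeasure M A = (\<integral>\<^sup>+w. emeasure M A \<partial>U)" by (simp add: U.emeasure_space_1)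
  also have "\<dots> = (\<integral>\<^sup>+w. (\<integral>\<^sup>+z. indicator A (z * sgn w) \<partial>M) \<partial>U)"
  proof (rule nn_integral_cong_AE)
    show "AE w in U. emeasure M A = (\<integral>\<^sup>+z. indicator A (z * sgn w) \<partial>M)"
      using \<open>AE w in U. w \<noteq> 0\<close>
    proof eventually_elim
      case (elim w)
      then have "sgn w = cis (Arg w)" by (simp add: cis_Arg)
      then have "(\<integral>\<^sup>+z. indicator A (z * sgn w) \<partial>M) = (\<integral>\<^sup>+z. indicator A z \<partial>M)"
        using rot[OF M(2,3), of "indicator A" "Arg w"] by (simp add: mult.commute)
      then show ?case using A M(2) by simp
    qed
  qed
  also have "\<dots> = (\<integral>\<^sup>+z. (\<integral>\<^sup>+w. indicator A (z * sgn w) \<partial>U) \<partial>M)"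
    by (rule P.Fubini') measurable
  also have "\<dots> = (\<integral>\<^sup>+z. (\<integral>\<^sup>+w. indicator A (complex_of_real (cmod z) * sgn w) \<partial>U) \<partial>M)"
  proof (rule nn_integral_cong)
    fix z
    have "sgn (cis (Arg z) * w) = cis (Arg z) * sgn w" for w
      by (simp add: sgn_div_norm norm_mult)
    moreover have "z = complex_of_real (cmod z) * cis (Arg z)"
      using rcis_cmod_Arg[of z] by (simp add: rcis_def)
    ultimately have "z * sgn w = complex_of_real (cmod z) * sgn (cis (Arg z) * w)" for w
      by (metis mult.assoc)
    then show "(\<integral>\<^sup>+w. indicator A (z * sgn w) \<partial>U) = (\<integral>\<^sup>+w. indicator A (complex_of_real (cmod z) * sgn w) \<partial>U)"
      using rot[OF U(2,3), of "\<lambda>w. indicator A (complex_of_real (cmod z) * sgn w)" "Arg z"] by simp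
  qed
  also have "\<dots> = (\<integral>\<^sup>+r. (\<integral>\<^sup>+w. indicator A (complex_of_real r * sgn w) \<partial>U) \<partial>distr M borel cmod)"
    by (rule nn_integral_distr[symmetric]) measurable
  finally show ?thesis .
qed

text \<open>
  The hypothesis speaks of positive radii only; the atom at the origin is recovered from right
  continuity of the distribution functions.
\<close>

lemma distr_cmod_eqI:
  assumes M: "prob_space M" "sets M = sets borel" and N: "prob_space N" "sets N = sets borel"
    and eq: "\<And>s. 0 < s \<Longrightarrow> measure M {z. cmod z \<le> s} = measure N {z. cmod z \<le> s}"
  shows "distr M borel cmod = distr N borel cmod"
proof (rule cdf_unique)
  have cmod: "cmod \<in> measurable L borel" if "sets L = sets borel" for L
    unfolding measurable_cong_sets[OF that refl] by simp
  show "real_distribution (distr M borel cmod)" "real_distribution (distr N borel cmod)"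
    using prob_space.real_distribution_distr[OF M(1) cmod[OF M(2)]]
      prob_space.real_distribution_distr[OF N(1) cmod[OF N(2)]] by auto
  have cdf: "cdf (distr L borel cmod) s = measure L {z. cmod z \<le> s}" if L: "sets L = sets borel" for L s
  proof -
    have "space L = UNIV" using sets_eq_imp_space_eq[OF L] by simp
    then show ?thesis unfolding cdf_def using cmod[OF L]
      by (subst measure_distr) (auto intro!: arg_cong[where f="measure L"])
  qed
  have pos: "cdf (distr M borel cmod) s = cdf (distr N borel cmod) s" if "0 < s" for s
    using eq[OF that] by (simp add: cdf M N)
  show "cdf (distr M borel cmod) = cdf (distr N borel cmod)"
  proof
    fix s :: real
    consider "0 < s" | "s = 0" | "s < 0" using linorder_less_linear[of s 0] by blast
    then show "cdf (distr M borel cmod) s = cdf (distr N borel cmod) s"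
    proof cases
      case 2
      have lim: "(cdf L \<longlongrightarrow> cdf L 0) (at_right 0)" if "finite_borel_measure L" for L
        using finite_borel_measure.cdf_is_right_cont[OF that, of 0] by (simp add: continuous_within)
      have fb: "finite_borel_measure (distr M borel cmod)" "finite_borel_measure (distr N borel cmod)"
        using prob_space.real_distribution_distr[OF M(1) cmod[OF M(2)]]
          prob_space.real_distribution_distr[OF N(1) cmod[OF N(2)]]
        by (auto intro: real_distribution.finite_borel_measure_M)
      have "\<forall>\<^sub>F s in at_right 0. cdf (distr M borel cmod) s = cdf (distr N borel cmod) s"
        using eventually_at_right_less[of "0::real"] by eventually_elim (rule pos)
      from Lim_transform_eventually[OF lim[OF fb(1)] this]
      have "(cdf (distr N borel cmod) \<longlongrightarrow> cdf (distr M borel cmod) 0) (at_right 0)" .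
      from tendsto_unique[OF _ this lim[OF fb(2)]] show ?thesis using 2 by simp
    next
      case 3
      then have "{z::complex. cmod z \<le> s} = {}" by (auto simp: not_le intro: less_le_trans)
      then show ?thesis by (simp add: cdf M N)
    qed (rule pos)
  qed
qed

lemma radially_symmetric_eqI:
  assumes M: "prob_space M" "sets M = sets borel" "radially_symmetric M"
    and N: "prob_space N" "sets N = sets borel" "radially_symmetric N"
    and eq: "\<And>s. 0 < s \<Longrightarrow> measure M {z. cmod z \<le> s} = measure N {z. cmod z \<le> s}"
  shows "M = N"
proof (rule measure_eqI)
  define U :: "complex measure" where "U = uniform_measure lborel {z. cmod z \<le> 1}"
  note disc = uniform_disc[OF zero_less_one, folded U_def]
  have "emeasure U {0} = 0"
    unfolding U_def by (subst emeasure_uniform_measure) (auto simp: disc_eq_cball)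
  note U = disc(1-3) this
  show "sets M = sets N" using M N by simp
  fix A assume "A \<in> sets M"
  then have A: "A \<in> sets borel" using M by simp
  show "emeasure M A = emeasure N A"
    unfolding radially_symmetric_emeasure[OF M U A] radially_symmetric_emeasure[OF N U A]
    using distr_cmod_eqI[OF M(1,2) N(1,2) eq] by simp
qed

lemma master_measure_eqI:
  assumes "prob_space M" "sets M = sets borel" "radially_symmetric M"
    and "\<And>s. 0 < s \<Longrightarrow> measure M {z. cmod z \<le> s} = master_cdf V s"
  shows "master_measure V = M"
  unfolding master_measure_def
proof (rule the_equality)
  show "prob_space M \<and> sets M = sets borel \<and> radially_symmetric M \<and>
      (\<forall>s>0. measure M {z. cmod z \<le> s} = master_cdf V s)"
    using assms by blast
  show "N = M" if "prob_space N \<and> sets N = sets borel \<and> radially_symmetric N \<and>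
      (\<forall>s>0. measure N {z. cmod z \<le> s} = master_cdf V s)" for N
    using that assms by (intro radially_symmetric_eqI) auto
qed

section \<open>Profiles diagonally similar to doubly stochastic matrices\<close>

lemma matrix_inv_diagonal:
  fixes D :: "real^'n^'n"
  assumes diag: "\<And>i j. i \<noteq> j \<Longrightarrow> D $ i $ j = 0" and pos: "\<And>i. 0 < D $ i $ i"
  shows "matrix_inv D $ i $ j = (if i = j then 1 / D $ i $ i else 0)"
proof -
  define E :: "real^'n^'n" where "E = (\<chi> i j. if i = j then 1 / D $ i $ i else 0)"
  have ne: "D $ i $ i \<noteq> 0" for i using pos[of i] by simp
  have "D ** E = mat 1"
    unfolding vec_eq_iff
  proof (intro allI)
    fix i j
    have "(D ** E) $ i $ j = (\<Sum>k\<in>UNIV. if k = i then D $ i $ i * E $ i $ j else 0)"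
      unfolding matrix_matrix_mult_def vec_lambda_beta by (intro sum.cong) (auto simp: diag)
    then show "(D ** E) $ i $ j = mat 1 $ i $ j" by (simp add: E_def mat_def ne)
  qed
  moreover have "E ** D = mat 1"
    unfolding vec_eq_iff
  proof (intro allI)
    fix i j
    have "(E ** D) $ i $ j = (\<Sum>k\<in>UNIV. if k = i then E $ i $ i * D $ i $ j else 0)"
      unfolding matrix_matrix_mult_def vec_lambda_beta by (intro sum.cong) (auto simp: E_def)
    then show "(E ** D) $ i $ j = mat 1 $ i $ j" by (simp add: E_def mat_def ne diag)
  qed
  ultimately have inv: "D ** E = mat 1 \<and> E ** D = mat 1" by blast
  have DE: "D ** matrix_inv D = mat 1 \<and> matrix_inv D ** D = mat 1"
    unfolding matrix_inv_def by (rule someI[of "\<lambda>A'. D ** A' = mat 1 \<and> A' ** D = mat 1", OF inv])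
  have "matrix_inv D = matrix_inv D ** (D ** E)" by (simp add: inv)
  also have "\<dots> = E" using DE by (simp add: matrix_mul_assoc)
  finally have "matrix_inv D = E" .
  then show ?thesis by (simp add: E_def)
qed

lemma diagonal_conjugation_nth:
  fixes D S :: "real^'n^'n"
  assumes diag: "\<And>i j. i \<noteq> j \<Longrightarrow> D $ i $ j = 0" and pos: "\<And>i. 0 < D $ i $ i"
  shows "(matrix_inv D ** S ** D) $ i $ j = S $ i $ j * D $ j $ j / D $ i $ i"
proof -
  have "(matrix_inv D ** S) $ i $ k = (\<Sum>m\<in>UNIV. if m = i then S $ i $ k / D $ i $ i else 0)" for k
    unfolding matrix_matrix_mult_def vec_lambda_beta
    by (intro sum.cong) (auto simp: matrix_inv_diagonal[OF diag pos])
  then have inv: "(matrix_inv D ** S) $ i $ k = S $ i $ k / D $ i $ i" for k by simp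
  have "(matrix_inv D ** S ** D) $ i $ j = (\<Sum>k\<in>UNIV. (matrix_inv D ** S) $ i $ k * D $ k $ j)"
    by (simp only: matrix_matrix_mult_def[of _ D] vec_lambda_beta)
  also have "\<dots> = (\<Sum>k\<in>UNIV. if k = j then S $ i $ j / D $ i $ i * D $ j $ j else 0)"
    by (intro sum.cong) (auto simp: inv diag)
  finally show ?thesis by simp
qed

text \<open>
  The form in which the equality case arises and is used: conjugation by \<open>diag(d)\<close> has
  constant column sums \<open>c\<close> iff \<open>d\<close> is a left eigenvector, and constant row sums \<open>c\<close> iff \<open>1 / d\<close> is a right
  eigenvector.
\<close>

lemma diagonally_doubly_stochastic_iff:
  fixes V :: "real^'n^'n"
  assumes nonneg: "\<And>i j. 0 \<le> V $ i $ j"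
  shows "(\<exists>D S. (\<forall>i j. i \<noteq> j \<longrightarrow> D $ i $ j = 0) \<and> (\<forall>i. 0 < D $ i $ i) \<and>
           doubly_stochastic S \<and> V = matrix_inv D ** S ** D) \<longleftrightarrow>
    (\<exists>d c. 0 < c \<and> (\<forall>i. 0 < d $ i) \<and> transpose V *v d = c *\<^sub>R d \<and>
       V *v (\<chi> i. 1 / d $ i) = c *\<^sub>R (\<chi> i. 1 / d $ i))" (is "?L \<longleftrightarrow> ?R")
proof
  assume ?L
  then obtain D S where diag: "\<And>i j. i \<noteq> j \<Longrightarrow> D $ i $ j = 0" and pos: "\<And>i. 0 < D $ i $ i"
    and S: "doubly_stochastic S" and V: "V = matrix_inv D ** S ** D" by blast
  obtain c where c: "0 < c" "\<And>i. (\<Sum>j\<in>UNIV. S $ i $ j) = c" "\<And>j. (\<Sum>i\<in>UNIV. S $ i $ j) = c"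
    using S by (auto simp: doubly_stochastic_def)
  have Vij: "V $ i $ j = S $ i $ j * D $ j $ j / D $ i $ i" for i j
    unfolding V by (rule diagonal_conjugation_nth[OF diag pos])
  have ne: "D $ i $ i \<noteq> 0" for i using pos[of i] by simp
  define d where "d = (\<chi> i. D $ i $ i)"
  have "(transpose V *v d) $ j = (\<Sum>i\<in>UNIV. S $ i $ j) * d $ j" for j
    unfolding transpose_vector_nth sum_distrib_right by (intro sum.cong) (simp_all add: Vij d_def ne)
  moreover have "(V *v (\<chi> i. 1 / d $ i)) $ i = (\<Sum>j\<in>UNIV. S $ i $ j) * (1 / d $ i)" for i
    unfolding matrix_vector_nth sum_distrib_right by (intro sum.cong) (simp_all add: Vij d_def ne)
  ultimately show ?R
    using c pos by (intro exI[of _ d] exI[of _ c]) (simp add: vec_eq_iff d_def)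
next
  assume ?R
  then obtain d c where c: "0 < c" and d: "\<And>i. 0 < d $ i" and left: "transpose V *v d = c *\<^sub>R d"
    and right: "V *v (\<chi> i. 1 / d $ i) = c *\<^sub>R (\<chi> i. 1 / d $ i)" by blast
  have ne: "d $ i \<noteq> 0" for i using d[of i] by simp
  define D :: "real^'n^'n" where "D = (\<chi> i j. if i = j then d $ i else 0)"
  define S :: "real^'n^'n" where "S = (\<chi> i j. d $ i * V $ i $ j / d $ j)"
  have D: "\<And>i j. i \<noteq> j \<Longrightarrow> D $ i $ j = 0" "\<And>i. 0 < D $ i $ i" using d by (auto simp: D_def)
  have rows: "(\<Sum>j\<in>UNIV. S $ i $ j) = c" for i
  proof -
    have "(\<Sum>j\<in>UNIV. S $ i $ j) = d $ i * (V *v (\<chi> i. 1 / d $ i)) $ i"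
      by (simp add: S_def matrix_vector_nth sum_distrib_left)
    then show ?thesis by (simp add: right ne)
  qed
  have cols: "(\<Sum>i\<in>UNIV. S $ i $ j) = c" for j
  proof -
    have "(\<Sum>i\<in>UNIV. S $ i $ j) = (transpose V *v d) $ j / d $ j"
      by (simp add: S_def transpose_vector_nth sum_divide_distrib mult.commute)
    then show ?thesis by (simp add: left ne)
  qed
  have "0 \<le> S $ i $ j" for i j
    using nonneg[of i j] d[of i] d[of j] by (simp add: S_def)
  then have "doubly_stochastic S" unfolding doubly_stochastic_def using c rows cols by blast
  moreover have "V = matrix_inv D ** S ** D"
    by (simp add: vec_eq_iff diagonal_conjugation_nth[OF D]) (simp add: S_def D_def ne)
  ultimately show ?L using D by blast
qed

context fully_indecomposable_profile
begin

text \<open>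
  For \<open>q = k d\<close> and \<open>q' = l / d\<close> one has \<open>V\<^sup>T q = c q\<close> and \<open>V q' = c q'\<close>, and all master equations collapse to
  the scalar equation \<open>s\<^sup>2 + c\<^sup>2 k l = c\<close>. It fixes the product \<open>w = k l\<close>; the quotient of \<open>k\<close> and \<open>l\<close> is
  fixed by the balance of the totals.
\<close>

lemma reciprocal_eigenvectors_cdf:
  assumes d: "\<And>i. 0 < d $ i" and c: "0 < c" and left: "transpose V *v d = c *\<^sub>R d"
    and right: "V *v (\<chi> i. 1 / d $ i) = c *\<^sub>R (\<chi> i. 1 / d $ i)"
  shows "spec_radius V = c"
    and "0 < s \<Longrightarrow> master_cdf V s = (if s < sqrt c then s\<^sup>2 / c else 1)"
proof -
  define h where "h = (\<chi> i. 1 / d $ i)"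
  have ne: "d $ i \<noteq> 0" for i using d[of i] by simp
  show rho: "spec_radius V = c"
    by (rule spec_radius_eq_perron[OF nonneg _ right]) (simp add: d)
  assume s: "0 < s"
  show "master_cdf V s = (if s < sqrt c then s\<^sup>2 / c else 1)"
  proof (cases "s < sqrt c")
    case False
    then show ?thesis by (simp add: master_cdf_def master_solution_def rho)
  next
    case True
    then have "s\<^sup>2 < (sqrt c)\<^sup>2" using s by (intro power_strict_mono) auto
    then have sc: "s\<^sup>2 < c" using c by simp
    define w where "w = (c - s\<^sup>2) / c\<^sup>2"
    have w: "0 < w" using sc c by (simp add: w_def)
    define A where "A = (\<Sum>i\<in>UNIV. d $ i)"
    define B where "B = (\<Sum>i\<in>UNIV. h $ i)"
    have A: "0 < A" unfolding A_def using d by (intro sum_pos) auto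
    have B: "0 < B" unfolding B_def h_def using d by (intro sum_pos) auto
    define k where "k = sqrt (w * B / A)"
    define l where "l = sqrt (w * A / B)"
    have k: "0 < k" and l: "0 < l" using w A B by (auto simp: k_def l_def)
    have "k * l = sqrt (w * w)" unfolding k_def l_def real_sqrt_mult[symmetric] using A B by simp
    then have kl: "k * l = w" using w by simp
    have kAlB: "k * A = l * B"
    proof -
      have "(k * A)\<^sup>2 = (l * B)\<^sup>2" using A B w
        by (simp add: k_def l_def power_mult_distrib) (simp add: power2_eq_square)
      then show ?thesis using k l A B by (simp add: power2_eq_iff_nonneg)
    qed
    define q where "q = k *\<^sub>R d"
    define q' where "q' = l *\<^sub>R h"
    have Vq: "V *v q' = c *\<^sub>R q'" using right by (simp add: q'_def h_def matrix_vector_mult_scaleR)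
    have Vtq: "transpose V *v q = c *\<^sub>R q" using left by (simp add: q_def matrix_vector_mult_scaleR)
    have qq: "q $ i * q' $ i = w" for i using kl ne[of i] by (simp add: q_def q'_def h_def)
    have den: "s\<^sup>2 + (V *v q') $ i * (transpose V *v q) $ i = c" for i
    proof -
      have "(V *v q') $ i * (transpose V *v q) $ i = c\<^sup>2 * (q $ i * q' $ i)"
        by (simp add: Vq Vtq power2_eq_square)
      then show ?thesis using c by (simp add: qq w_def)
    qed
    have M: "master_equations V s q q'"
      unfolding master_equations_def den
    proof (intro conjI allI)
      show "q $ i = (transpose V *v q) $ i / c" "q' $ i = (V *v q') $ i / c" for i
        using c by (simp_all add: Vq Vtq)
      show "(\<Sum>i\<in>UNIV. q $ i) = (\<Sum>i\<in>UNIV. q' $ i)"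
        using kAlB by (simp add: q_def q'_def A_def B_def sum_distrib_left)
      show "0 \<le> q $ i" "0 \<le> q' $ i" for i
        using k l d[of i] by (simp_all add: q_def q'_def h_def)
    qed
    have "q \<noteq> 0"
    proof
      assume "q = 0"
      then have "w = 0" using qq[of undefined] by simp
      then show False using w by simp
    qed
    then have "master_solution V s = (q, q')"
      using s True by (intro master_solution_eqI M) (auto simp: rho)
    from master_cdf_eq[OF s M this] show ?thesis using True by (simp add: den)
  qed
qed

lemma reciprocal_eigenvectors_density:
  assumes d: "\<And>i. 0 < d $ i" and c: "0 < c" and left: "transpose V *v d = c *\<^sub>R d"
    and right: "V *v (\<chi> i. 1 / d $ i) = c *\<^sub>R (\<chi> i. 1 / d $ i)"
  shows "(punctured_density V \<longlongrightarrow> 1 / (pi * c)) (at 0)"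
proof -
  note cdf = reciprocal_eigenvectors_cdf[OF assms]
  have dens: "punctured_density V z = 1 / (pi * c)" if z: "z \<noteq> 0" "cmod z < sqrt c" for z
  proof -
    have "((\<lambda>s. s\<^sup>2 / c) has_real_derivative 2 * cmod z / c) (at (cmod z))"
      using c by (auto intro!: derivative_eq_intros)
    then have "(master_cdf V has_real_derivative 2 * cmod z / c) (at (cmod z))"
      by (rule has_field_derivative_transform_within_open[where S="{0<..<sqrt c}"]) (use z cdf in auto)
    then have "deriv (master_cdf V) (cmod z) = 2 * cmod z / c" by (rule DERIV_imp_deriv)
    then show ?thesis using z by (simp add: punctured_density_def cdf)
  qed
  have "\<forall>\<^sub>F z in at 0. 1 / (pi * c) = punctured_density V z"
    unfolding eventually_at using c dens by (intro exI[of _ "sqrt c"]) auto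
  then show ?thesis by (rule Lim_transform_eventually[OF tendsto_const])
qed

end

theorem corollary2p9:
  fixes \<sigma> V :: "real^'n^'n"
  assumes "\<forall>i j. 0 \<le> \<sigma> $ i $ j"
    and "V = normalized_variance_profile \<sigma>"
    and "bounded_profile \<sigma>"
    and "block_fully_indecomposable V"
  shows "(master_density V \<longlongrightarrow> master_density V 0) (at 0) \<and>
         master_density V 0 \<ge> 1 / (pi * spec_radius V) \<and>
         (master_density V 0 = 1 / (pi * spec_radius V) \<longleftrightarrow>
            (\<exists>D S. (\<forall>i j. i \<noteq> j \<longrightarrow> D $ i $ j = 0) \<and> (\<forall>i. 0 < D $ i $ i) \<and>
                   doubly_stochastic S \<and> V = matrix_inv D ** S ** D)) \<and>
         ((\<exists>D S. (\<forall>i j. i \<noteq> j \<longrightarrow> D $ i $ j = 0) \<and> (\<forall>i. 0 < D $ i $ i) \<and>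
                 doubly_stochastic S \<and> V = matrix_inv D ** S ** D) \<longrightarrow>
            master_measure V =
              uniform_measure lborel {z. cmod z \<le> sqrt (spec_radius V)})"
proof -
  have nn: "0 \<le> V $ i $ j" for i j using assms(2) by (simp add: normalized_variance_profile_def)
  interpret fully_indecomposable_profile V
    using nn assms(4) by (rule block_fully_indecomposable_imp_profile)
  define \<rho> where "\<rho> = spec_radius V"
  have \<rho>: "0 < \<rho>" using spec_radius_pos by (simp add: \<rho>_def)
  obtain p p' where p: "\<And>i. 0 < p $ i" "\<And>i. 0 < p' $ i"
    and rows: "\<And>i. p $ i * (V *v p') $ i = 1" and cols: "\<And>i. p' $ i * (transpose V *v p) $ i = 1"
    and bal: "(\<Sum>i\<in>UNIV. p $ i) = (\<Sum>i\<in>UNIV. p' $ i)"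
    using sinkhorn_scaling by blast
  have p_ne: "p $ i \<noteq> 0" "p' $ i \<noteq> 0" for i using p(1)[of i] p(2)[of i] by auto
  obtain x l where x: "\<And>i. 0 < x $ i" and "0 < l" and eig: "V *v x = l *\<^sub>R x"
    using perron_vector by blast
  have l: "l = \<rho>" using spec_radius_eq_perron[OF nonneg x eig] by (simp add: \<rho>_def)
  note scaled = scaled_sum_ge[OF p rows cols x eig, unfolded l]
  define L where "L = (\<Sum>i\<in>UNIV. p $ i * p' $ i) / (pi * real CARD('n))"
  have lim: "(punctured_density V \<longlongrightarrow> L) (at 0)"
    unfolding L_def by (rule punctured_density_tendsto[OF p rows cols bal])
  have f0: "master_density V 0 = L"
    using lim by (simp add: master_density_def tendsto_Lim)
  have "\<forall>\<^sub>F z in at 0. punctured_density V z = master_density V z"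
    by (simp add: eventually_at master_density_def exI[of _ 1])
  with lim have tends: "(master_density V \<longlongrightarrow> master_density V 0) (at 0)"
    unfolding f0 by (rule Lim_transform_eventually)
  have ge: "1 / (pi * \<rho>) \<le> L"
    using scaled(1) \<rho> by (simp add: L_def field_simps)
  let ?R = "\<exists>d c. 0 < c \<and> (\<forall>i. 0 < d $ i) \<and> transpose V *v d = c *\<^sub>R d \<and>
       V *v (\<chi> i. 1 / d $ i) = c *\<^sub>R (\<chi> i. 1 / d $ i)"
  have to_R: ?R if "L = 1 / (pi * \<rho>)"
  proof -
    have "real CARD('n) = \<rho> * (\<Sum>i\<in>UNIV. p $ i * p' $ i)"
      using that \<rho> by (simp add: L_def field_simps)
    then have one: "\<rho> * p $ i * p' $ i = 1" for i by (rule scaled(2))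
    have inv: "(\<chi> i. 1 / p $ i) = \<rho> *\<^sub>R p'"
      using one p_ne by (simp add: vec_eq_iff field_simps)
    have Vp': "V *v p' = (\<chi> i. 1 / p $ i)"
      using rows p_ne by (simp add: vec_eq_iff field_simps)
    have "transpose V *v p = \<rho> *\<^sub>R p"
      unfolding vec_eq_iff
    proof
      fix i
      have "(transpose V *v p) $ i = 1 / p' $ i" using cols[of i] p_ne[of i] by (simp add: field_simps)
      also have "\<dots> = \<rho> * p $ i" using one[of i] p_ne[of i] by (simp add: field_simps)
      finally show "(transpose V *v p) $ i = (\<rho> *\<^sub>R p) $ i" by simp
    qed
    moreover have "V *v (\<chi> i. 1 / p $ i) = \<rho> *\<^sub>R (\<chi> i. 1 / p $ i)"
      unfolding inv by (simp only: matrix_vector_mult_scaleR Vp' inv)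
    ultimately show ?thesis using \<rho> p by blast
  qed
  have from_R: "L = 1 / (pi * \<rho>) \<and>
      master_measure V = uniform_measure lborel {z. cmod z \<le> sqrt \<rho>}" if R: ?R
  proof -
    obtain d c where c: "0 < c" and d: "\<And>i. 0 < d $ i" and lr: "transpose V *v d = c *\<^sub>R d"
       "V *v (\<chi> i. 1 / d $ i) = c *\<^sub>R (\<chi> i. 1 / d $ i)" using R by blast
    note cdf = reciprocal_eigenvectors_cdf[OF d c lr]
    have c\<rho>: "c = \<rho>" using cdf(1) by (simp add: \<rho>_def)
    have "L = 1 / (pi * \<rho>)"
      using tendsto_unique[OF _ lim reciprocal_eigenvectors_density[OF d c lr]] by (simp add: c\<rho>)
    moreover have "master_measure V = uniform_measure lborel {z. cmod z \<le> sqrt \<rho>}"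
    proof (rule master_measure_eqI)
      have sq: "0 < sqrt \<rho>" using \<rho> by simp
      show "prob_space (uniform_measure lborel {z::complex. cmod z \<le> sqrt \<rho>})"
        "sets (uniform_measure lborel {z::complex. cmod z \<le> sqrt \<rho>}) = sets borel"
        "radially_symmetric (uniform_measure lborel {z. cmod z \<le> sqrt \<rho>})"
        by (rule uniform_disc[OF sq])+
      show "measure (uniform_measure lborel {z. cmod z \<le> sqrt \<rho>}) {z. cmod z \<le> s} = master_cdf V s"
        if "0 < s" for s
        using uniform_disc(4)[OF sq, of s] cdf(2)[OF that] that \<rho> by (simp add: c\<rho>)
    qed
    ultimately show ?thesis by blast
  qed
  show ?thesis
    unfolding diagonally_doubly_stochastic_iff[OF nonneg] \<rho>_def[symmetric] f0
    using tends[unfolded f0] ge to_R from_R by blast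
qed

end
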